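(* There exist positive numerical constants $c,c',C,K_0$ such that the following holds. Assume that $p\geq c\log(K)$, $K\geq K_0$, $n\geq 2K$ and $\alpha\geq\frac32$, and let $\sigma>0$, $\bar\Delta>0$. If $$\bar\Delta^{2}\leq c'\left(\log(K)\vee\sqrt{\frac{pK\log(K)}{n}}\right),$$ then, for any estimator $\hat G$ (a measurable map from the observations $(Y_1,\ldots,Y_n)$ to partitions of $\{1,\ldots,n\}$ into $K$ groups), $$\sup_{G\in\mathcal{P}_\alpha}\ \sup_{\mu\in\Theta_{\bar\Delta}}\mathbb{E}_{\mu,G}\left[err(\hat G,G)\right]\geq C.$$
   Context: $\mathcal{P}_\alpha$ is the set of partitions $G=\{G_1,\ldots,G_K\}$ of $\{1,\ldots,n\}$ into $K$ (nonempty, numbered) groups such that $\max_k|G_k|/\min_k|G_k|\leq\alpha$. $\Theta_{\bar\Delta}$ is the set of $K$-tuples $\mu=(\mu_1,\ldots,\mu_K)\in(\mathbb{R}^p)^K$ such that $\min_{l\neq r}\frac{\|\mu_r-\mu_l\|^2}{2\sigma^2}\geq\bar\Delta^2$. For $\mu\in(\mathbb{R}^p)^K$ and a partition $G$, $\mathbb{P}_{\mu,G}$ (with expectation $\mathbb{E}_{\mu,G}$) is the law of $(Y_1,\ldots,Y_n)\in(\mathbb{R}^p)^n$ where the $Y_i$ are independent and $Y_i\sim\mathcal{N}(\mu_k,\sigma^2I_p)$ when $i\in G_k$. Clustering error: $err(\hat G,G)=\frac{1}{2n}\min_{\pi\in\mathcal{S}_K}\sum_{k=1}^K|G_k\,\triangle\,\hat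 G_{\pi(k)}|$, with $\triangle$ the symmetric difference and $\mathcal{S}_K$ the permutations of $\{1,\ldots,K\}$. Notation: $a\vee b=\max(a,b)$. *)

theory Defs
  imports "HOL-Probability.Probability" "HOL-Combinatorics.Combinatorics"
begin

text \<open>
  The dimension \<open>p\<close> is quantified inside the theorem, after the numerical constants, so a vector
  of \<open>\<real>\<^sup>p\<close> is a function in \<open>{1..p} \<rightarrow>\<^sub>E UNIV\<close>; its Euclidean norm is \<^const>\<open>L2_set\<close> over
  \<open>{1..p}\<close>. Families indexed by \<open>{1..K}\<close> or \<open>{1..n}\<close> are likewise extensional functions.
\<close>

text \<open>Partitions with \<open>K\<close> numbered groups; \<^const>\<open>partition_on\<close> makes the groups nonempty and
  disjoint, injectivity makes their number exactly \<open>K\<close>.\<close>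

definition numbered_partitions :: "nat \<Rightarrow> nat \<Rightarrow> (nat \<Rightarrow> nat set) set" where
  "numbered_partitions n K =
     {G \<in> {1..K} \<rightarrow>\<^sub>E Pow {1..n}. inj_on G {1..K} \<and> partition_on {1..n} (G ` {1..K})}"

definition balanced_partitions :: "nat \<Rightarrow> nat \<Rightarrow> real \<Rightarrow> (nat \<Rightarrow> nat set) set" where
  "balanced_partitions n K \<alpha> =
     {G \<in> numbered_partitions n K.
        real (Max ((\<lambda>k. card (G k)) ` {1..K})) / real (Min ((\<lambda>k. card (G k)) ` {1..K})) \<le> \<alpha>}"

definition separated_means ::
    "nat \<Rightarrow> nat \<Rightarrow> real \<Rightarrow> real \<Rightarrow> (nat \<Rightarrow> nat \<Rightarrow> real) set" where
  "separated_means p K \<sigma> \<Delta> =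
     {\<mu> \<in> {1..K} \<rightarrow>\<^sub>E ({1..p} \<rightarrow>\<^sub>E UNIV).
        \<forall>l\<in>{1..K}. \<forall>r\<in>{1..K}. l \<noteq> r \<longrightarrow>
          (L2_set (\<lambda>j. \<mu> r j - \<mu> l j) {1..p})\<^sup>2 / (2 * \<sigma>\<^sup>2) \<ge> \<Delta>\<^sup>2}"

text \<open>The isotropic Gaussian law with mean \<open>m\<close> and covariance \<open>\<sigma>\<^sup>2 I\<close> is the product of its
  one-dimensional marginals; the second argument of \<^const>\<open>normal_density\<close> is the standard
  deviation.\<close>

definition gaussian_law :: "nat \<Rightarrow> (nat \<Rightarrow> real) \<Rightarrow> real \<Rightarrow> (nat \<Rightarrow> real) measure" where
  "gaussian_law p m \<sigma> = Pi\<^sub>M {1..p} (\<lambda>j. density lborel (normal_density (m j) \<sigma>))"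

definition group_index :: "nat \<Rightarrow> (nat \<Rightarrow> nat set) \<Rightarrow> nat \<Rightarrow> nat" where
  "group_index K G i = (THE k. k \<in> {1..K} \<and> i \<in> G k)"

definition sample_law ::
    "nat \<Rightarrow> nat \<Rightarrow> nat \<Rightarrow> real \<Rightarrow> (nat \<Rightarrow> nat \<Rightarrow> real) \<Rightarrow> (nat \<Rightarrow> nat set)
      \<Rightarrow> (nat \<Rightarrow> nat \<Rightarrow> real) measure" where
  "sample_law n p K \<sigma> \<mu> G = Pi\<^sub>M {1..n} (\<lambda>i. gaussian_law p (\<mu> (group_index K G i)) \<sigma>)"

definition observation_space :: "nat \<Rightarrow> nat \<Rightarrow> (nat \<Rightarrow> nat \<Rightarrow> real) measure" where
  "observation_space n p = Pi\<^sub>M {1..n} (\<lambda>_. Pi\<^sub>M {1..p} (\<lambda>_. borel))"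

definition estimators ::
    "nat \<Rightarrow> nat \<Rightarrow> nat \<Rightarrow> ((nat \<Rightarrow> nat \<Rightarrow> real) \<Rightarrow> nat \<Rightarrow> nat set) set" where
  "estimators n p K = observation_space n p \<rightarrow>\<^sub>M count_space (numbered_partitions n K)"

definition clustering_error ::
    "nat \<Rightarrow> nat \<Rightarrow> (nat \<Rightarrow> nat set) \<Rightarrow> (nat \<Rightarrow> nat set) \<Rightarrow> real" where
  "clustering_error n K G' G =
     1 / (2 * real n) *
     real (Min {\<Sum>k=1..K. card (sym_diff (G k) (G' (\<pi> k))) | \<pi>. \<pi> permutes {1..K}})"

end

theory Submission
  imports Defs
begin

text \<open>
  The lower bound is Bayesian. Both the partition and the means are drawn at random, and the data are
  compared with pure noise, which carries no information on the partition. The groups come from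
  a fixed balanced partition by a uniformly random permutation \<open>\<tau>\<close> of the points. The means are
  \<open>\<mu>\<^sub>k = \<sigma> \<epsilon> s\<^sub>k\<close>, where \<open>\<epsilon>\<^sup>2 = 2 \<Delta>\<^sup>2 / p\<close> and the rows \<open>s\<^sub>k \<in> {-1, 1}\<^sup>p\<close> form a uniformly random
  matrix among those whose rows have pairwise inner products at most \<open>p / 2\<close>. Such means satisfy the
  separation constraint. When \<open>p \<ge> 24 ln K\<close> these matrices are at least half of all sign matrices, by a
  Chernoff bound on each pair of rows (\<open>card_separated_sign_matrices\<close>).

  Two estimates carry the proof. First, the mixture over \<open>s\<close> of the likelihood ratios against pure noise
  has second moment at most \<open>2 \<Prod>\<^sub>k cosh (\<epsilon>\<^sup>2 m\<^sub>k) ^ p\<close>, where \<open>m\<^sub>k\<close> are the group sizes: two independent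
  sign matrices \<open>s, s'\<close> contribute \<open>exp (\<epsilon>\<^sup>2 \<Sum>\<^sub>k m\<^sub>k \<langle>s\<^sub>k, s'\<^sub>k\<rangle>)\<close>, whose average over all sign matrices
  factorises (\<open>second_moment_mixture\<close>). The two terms of the maximum in the hypothesis on \<open>\<Delta>\<close> correspond to
  the two bounds \<open>cosh a \<le> exp a\<close> and \<open>cosh a \<le> exp (a\<^sup>2 / 2)\<close>: the first is useful when the groups are
  large and the means could be estimated, the second when they cannot. Either way the second moment
  is at most \<open>V = 2 exp (n ln K / 8)\<close> (\<open>prod_cosh_le\<close>).

  Secondly, whatever partition the estimator returns, at most a fraction \<open>9^n exp (- n ln K / 4)\<close>
  of the permutations \<open>\<tau>\<close> is within error \<open>1 / 8\<close> of it (\<open>small_clustering_error_rare\<close>). The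
  assumption \<open>n \<ge> 2 K\<close> is essential here: the error is blind to the \<open>K!\<close> relabellings of the groups, and
  \<open>K! \<le> K^K\<close> is at most the square root of the number \<open>K^n\<close> of all labellings.

  For large \<open>K\<close> the rarity beats the second moment. By the inequality \<open>L \<le> L\<^sup>2 / (4 V) + V\<close>, applied
  to the likelihood ratio \<open>L\<close> of the mixture on the event of small error, the average probability of that event is at
  most \<open>3 / 8\<close> (\<open>exists_hard_hypothesis\<close>). Hence one partition and one tuple of means have error at least
  \<open>1 / 8\<close> with probability at least \<open>5 / 8\<close>.
\<close>

section \<open>Gaussian likelihood ratios against pure noise\<close>

text \<open>Products of densities are densities of products. Applied once across coordinates and once across
  observations, this turns the nested product law of the sample into a density against pure noise.\<close>

lemma PiM_density:
  fixes f :: "'i \<Rightarrow> 'a \<Rightarrow> ennreal"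
  assumes I: "finite I" and M: "product_sigma_finite M"
    and fM: "product_sigma_finite (\<lambda>i. density (M i) (f i))"
    and f[measurable]: "\<And>i. f i \<in> borel_measurable (M i)"
  shows "PiM I (\<lambda>i. density (M i) (f i)) = density (PiM I M) (\<lambda>x. \<Prod>i\<in>I. f i (x i))"
proof -
  interpret M: product_sigma_finite M by fact
  interpret fM: product_sigma_finite "\<lambda>i. density (M i) (f i)" by fact
  have "density (PiM I M) (\<lambda>x. \<Prod>i\<in>I. f i (x i)) = PiM I (\<lambda>i. density (M i) (f i))"
  proof (rule fM.PiM_eqI[OF I])
    show "sets (density (PiM I M) (\<lambda>x. \<Prod>i\<in>I. f i (x i))) = sets (PiM I (\<lambda>i. density (M i) (f i)))"
      by (simp cong: sets_PiM_cong)
  next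
    fix A assume "\<And>i. i \<in> I \<Longrightarrow> A i \<in> sets (density (M i) (f i))"
    then have A[measurable]: "\<And>i. i \<in> I \<Longrightarrow> A i \<in> sets (M i)" by simp
    have [measurable]: "Pi\<^sub>E I A \<in> sets (PiM I M)"
      using I A by (rule sets_PiM_I_finite)
    have "emeasure (density (PiM I M) (\<lambda>x. \<Prod>i\<in>I. f i (x i))) (Pi\<^sub>E I A)
        = (\<integral>\<^sup>+x. (\<Prod>i\<in>I. f i (x i)) * indicator (Pi\<^sub>E I A) x \<partial>PiM I M)"
      by (rule emeasure_density) measurable
    also have "\<dots> = (\<integral>\<^sup>+x. (\<Prod>i\<in>I. f i (x i) * indicator (A i) (x i)) \<partial>PiM I M)"
    proof (rule nn_integral_cong)
      fix x assume x: "x \<in> space (PiM I M)"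
      show "(\<Prod>i\<in>I. f i (x i)) * indicator (Pi\<^sub>E I A) x = (\<Prod>i\<in>I. f i (x i) * indicator (A i) (x i))"
      proof (cases "\<forall>i\<in>I. x i \<in> A i")
        case True
        then show ?thesis using x by (auto simp: space_PiM PiE_iff)
      next
        case False
        then have "x \<notin> Pi\<^sub>E I A" by auto
        moreover have "(\<Prod>i\<in>I. f i (x i) * indicator (A i) (x i)) = 0"
          using False I by (intro prod_zero) (auto simp: indicator_def)
        ultimately show ?thesis by simp
      qed
    qed
    also have "\<dots> = (\<Prod>i\<in>I. \<integral>\<^sup>+x. f i x * indicator (A i) x \<partial>M i)"
      using I by (intro M.product_nn_integral_prod) measurable
    also have "\<dots> = (\<Prod>i\<in>I. emeasure (density (M i) (f i)) (A i))"
      by (intro prod.cong refl) (simp add: emeasure_density)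
    finally show "emeasure (density (PiM I M) (\<lambda>x. \<Prod>i\<in>I. f i (x i))) (Pi\<^sub>E I A)
        = (\<Prod>i\<in>I. emeasure (density (M i) (f i)) (A i))" .
  qed
  then show ?thesis ..
qed

text \<open>The density of \<open>N(m, \<sigma>\<^sup>2)\<close> with respect to \<open>N(0, \<sigma>\<^sup>2)\<close>.\<close>

definition shift_ratio :: "real \<Rightarrow> real \<Rightarrow> real \<Rightarrow> real" where
  "shift_ratio \<sigma> m x = exp ((m * x - m\<^sup>2 / 2) / \<sigma>\<^sup>2)"

lemma shift_ratio_nonneg [simp]: "0 \<le> shift_ratio \<sigma> m x"
  by (simp add: shift_ratio_def)

lemma borel_measurable_shift_ratio [measurable]: "shift_ratio \<sigma> m \<in> borel_measurable borel"
  unfolding shift_ratio_def by measurable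

lemma normal_density_shift:
  assumes "\<sigma> > 0"
  shows "normal_density 0 \<sigma> x * shift_ratio \<sigma> m x = normal_density m \<sigma> x"
proof -
  have "- x\<^sup>2 / (2 * \<sigma>\<^sup>2) + (m * x - m\<^sup>2 / 2) / \<sigma>\<^sup>2 = - (x - m)\<^sup>2 / (2 * \<sigma>\<^sup>2)"
    using assms by (simp add: field_simps power2_eq_square)
  then show ?thesis
    by (simp add: normal_density_def shift_ratio_def flip: exp_add)
qed

lemma normal_law_shift:
  assumes "\<sigma> > 0"
  shows "density lborel (normal_density m \<sigma>) =
    density (density lborel (normal_density 0 \<sigma>)) (\<lambda>x. ennreal (shift_ratio \<sigma> m x))"
  using assms
  by (subst density_density_eq) (auto simp: ennreal_mult'[symmetric] normal_density_shift)

text \<open>Completing the square: the product of the ratios for \<open>m\<close> and \<open>m'\<close> is the ratio for \<open>m + m'\<close>, which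
  integrates to one, times the constant \<open>exp (m m' / \<sigma>\<^sup>2)\<close>.\<close>

lemma second_moment_shift_ratio:
  assumes "\<sigma> > 0"
  shows "(\<integral>\<^sup>+x. ennreal (shift_ratio \<sigma> m x * shift_ratio \<sigma> m' x) \<partial>density lborel (normal_density 0 \<sigma>))
    = ennreal (exp (m * m' / \<sigma>\<^sup>2))"
proof -
  interpret P: prob_space "density lborel (normal_density (m + m') \<sigma>)"
    using assms by (rule prob_space_normal_density)
  have eq: "shift_ratio \<sigma> m x * shift_ratio \<sigma> m' x
      = exp (m * m' / \<sigma>\<^sup>2) * shift_ratio \<sigma> (m + m') x" for x
    using assms by (simp add: shift_ratio_def field_simps power2_eq_square flip: exp_add)
  have "(\<integral>\<^sup>+x. ennreal (shift_ratio \<sigma> m x * shift_ratio \<sigma> m' x) \<partial>density lborel (normal_density 0 \<sigma>))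
      = (\<integral>\<^sup>+x. ennreal (exp (m * m' / \<sigma>\<^sup>2)) * ennreal (normal_density (m + m') \<sigma> x) \<partial>lborel)"
    unfolding eq using assms
    by (subst nn_integral_density)
      (auto simp: ennreal_mult'[symmetric] mult.left_commute normal_density_shift intro!: nn_integral_cong)
  also have "\<dots> = ennreal (exp (m * m' / \<sigma>\<^sup>2)) * emeasure (density lborel (normal_density (m + m') \<sigma>)) UNIV"
    by (simp add: nn_integral_cmult emeasure_density)
  also have "\<dots> = ennreal (exp (m * m' / \<sigma>\<^sup>2))"
    using P.emeasure_space_1 by simp
  finally show ?thesis .
qed

text \<open>The law of the sample in terms of the \<open>n \<times> p\<close> matrix of means of the observations, through
  which alone the partition and the group means act; \<open>m i j\<close> is the mean of coordinate \<open>j\<close> of observation \<open>i\<close>.\<close>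

definition signal_law :: "nat \<Rightarrow> nat \<Rightarrow> real \<Rightarrow> (nat \<Rightarrow> nat \<Rightarrow> real) \<Rightarrow> (nat \<Rightarrow> nat \<Rightarrow> real) measure" where
  "signal_law n p \<sigma> m = Pi\<^sub>M {1..n} (\<lambda>i. gaussian_law p (m i) \<sigma>)"

abbreviation noise_law :: "nat \<Rightarrow> nat \<Rightarrow> real \<Rightarrow> (nat \<Rightarrow> nat \<Rightarrow> real) measure" where
  "noise_law n p \<sigma> \<equiv> signal_law n p \<sigma> (\<lambda>_ _. 0)"

text \<open>The density of \<^const>\<open>signal_law\<close> with respect to pure noise, see \<open>signal_law_eq_density\<close>.\<close>

definition likelihood :: "nat \<Rightarrow> nat \<Rightarrow> real \<Rightarrow> (nat \<Rightarrow> nat \<Rightarrow> real) \<Rightarrow> (nat \<Rightarrow> nat \<Rightarrow> real) \<Rightarrow> real" where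
  "likelihood n p \<sigma> m y = (\<Prod>i=1..n. \<Prod>j=1..p. shift_ratio \<sigma> (m i j) (y i j))"

lemma likelihood_nonneg: "0 \<le> likelihood n p \<sigma> m y"
  by (simp add: likelihood_def prod_nonneg)

lemma sets_gaussian_law [measurable_cong]:
  "sets (gaussian_law p m \<sigma>) = sets (Pi\<^sub>M {1..p} (\<lambda>_. borel))"
  unfolding gaussian_law_def by (intro sets_PiM_cong) auto

lemma sets_signal_law [measurable_cong]:
  "sets (signal_law n p \<sigma> m) = sets (observation_space n p)"
  unfolding signal_law_def observation_space_def by (intro sets_PiM_cong sets_gaussian_law) auto

lemma borel_measurable_likelihood:
  "likelihood n p \<sigma> m \<in> borel_measurable (observation_space n p)"
proof -
  have [measurable]: "(\<lambda>y. y i j) \<in> borel_measurable (observation_space n p)"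
    if i: "i \<in> {1..n}" and j: "j \<in> {1..p}" for i j
    unfolding observation_space_def
    by (rule measurable_compose[OF measurable_component_singleton[OF i]
          measurable_component_singleton[OF j]])
  show ?thesis
    unfolding likelihood_def by measurable
qed

lemma prob_space_gaussian_law:
  assumes "\<sigma> > 0" shows "prob_space (gaussian_law p m \<sigma>)"
  unfolding gaussian_law_def by (intro prob_space_PiM prob_space_normal_density assms)

lemma prob_space_signal_law:
  assumes "\<sigma> > 0" shows "prob_space (signal_law n p \<sigma> m)"
  unfolding signal_law_def by (intro prob_space_PiM prob_space_gaussian_law assms)

lemma product_sigma_finite_normal:
  assumes "\<sigma> > 0"
  shows "product_sigma_finite (\<lambda>j. density lborel (normal_density (m j) \<sigma>))"
  by (intro product_sigma_finite.intro prob_space_imp_sigma_finite prob_space_normal_density assms)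

lemma product_sigma_finite_gaussian_law:
  assumes "\<sigma> > 0"
  shows "product_sigma_finite (\<lambda>i. gaussian_law p (m i) \<sigma>)"
  by (intro product_sigma_finite.intro prob_space_imp_sigma_finite prob_space_gaussian_law assms)

lemma gaussian_law_shift:
  assumes "\<sigma> > 0"
  shows "gaussian_law p m \<sigma> =
    density (gaussian_law p (\<lambda>_. 0) \<sigma>) (\<lambda>x. ennreal (\<Prod>j=1..p. shift_ratio \<sigma> (m j) (x j)))"
proof -
  have "gaussian_law p m \<sigma> = Pi\<^sub>M {1..p} (\<lambda>j. density (density lborel (normal_density 0 \<sigma>))
      (\<lambda>x. ennreal (shift_ratio \<sigma> (m j) x)))"
    unfolding gaussian_law_def by (subst normal_law_shift[OF assms]) (rule refl)
  also have "\<dots> = density (gaussian_law p (\<lambda>_. 0) \<sigma>)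
      (\<lambda>x. \<Prod>j=1..p. ennreal (shift_ratio \<sigma> (m j) (x j)))"
    unfolding gaussian_law_def
    by (rule PiM_density) (auto simp flip: normal_law_shift[OF assms]
        intro: product_sigma_finite_normal[OF assms])
  finally show ?thesis by (simp add: prod_ennreal)
qed

lemma signal_law_eq_density:
  assumes "\<sigma> > 0"
  shows "signal_law n p \<sigma> m =
    density (noise_law n p \<sigma>) (\<lambda>y. ennreal (likelihood n p \<sigma> m y))"
proof -
  have "signal_law n p \<sigma> m = Pi\<^sub>M {1..n} (\<lambda>i. density (gaussian_law p (\<lambda>_. 0) \<sigma>)
      (\<lambda>x. ennreal (\<Prod>j=1..p. shift_ratio \<sigma> (m i j) (x j))))"
    unfolding signal_law_def by (subst gaussian_law_shift[OF assms]) (rule refl)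
  also have "\<dots> = density (noise_law n p \<sigma>)
      (\<lambda>y. \<Prod>i=1..n. ennreal (\<Prod>j=1..p. shift_ratio \<sigma> (m i j) (y i j)))"
    unfolding signal_law_def
  proof (rule PiM_density)
    show "product_sigma_finite (\<lambda>i. density (gaussian_law p (\<lambda>_. 0) \<sigma>)
        (\<lambda>x. ennreal (\<Prod>j = 1..p. shift_ratio \<sigma> (m i j) (x j))))"
      by (subst gaussian_law_shift[OF assms, symmetric]) (rule product_sigma_finite_gaussian_law[OF assms])
  qed (auto intro: product_sigma_finite_gaussian_law[OF assms])
  finally show ?thesis by (simp add: prod_ennreal prod_nonneg likelihood_def)
qed

text \<open>Only the overlap of the two matrices of means matters. This exact formula is what makes mixtures over
  discrete means tractable, as their second moment is a double sum of exponentials of overlaps.\<close>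

lemma second_moment_likelihood:
  assumes "\<sigma> > 0"
  shows "(\<integral>\<^sup>+y. ennreal (likelihood n p \<sigma> m y * likelihood n p \<sigma> m' y) \<partial>noise_law n p \<sigma>)
    = ennreal (exp (\<Sum>i=1..n. \<Sum>j=1..p. m i j * m' i j / \<sigma>\<^sup>2))"
proof -
  interpret N: product_sigma_finite "\<lambda>j::nat. density lborel (normal_density 0 \<sigma>)"
    by (rule product_sigma_finite_normal[OF assms])
  interpret G: product_sigma_finite "\<lambda>i::nat. gaussian_law p (\<lambda>_. 0) \<sigma>"
    by (rule product_sigma_finite_gaussian_law[OF assms])
  let ?r = "\<lambda>i j x. ennreal (shift_ratio \<sigma> (m i j) x * shift_ratio \<sigma> (m' i j) x)"
  have inner: "(\<integral>\<^sup>+x. (\<Prod>j=1..p. ?r i j (x j)) \<partial>gaussian_law p (\<lambda>_. 0) \<sigma>)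
      = ennreal (\<Prod>j=1..p. exp (m i j * m' i j / \<sigma>\<^sup>2))" for i
    unfolding gaussian_law_def
    by (subst N.product_nn_integral_prod) (auto simp: second_moment_shift_ratio[OF assms] prod_ennreal)
  have "(\<integral>\<^sup>+y. ennreal (likelihood n p \<sigma> m y * likelihood n p \<sigma> m' y) \<partial>noise_law n p \<sigma>)
      = (\<integral>\<^sup>+y. (\<Prod>i=1..n. \<Prod>j=1..p. ?r i j (y i j)) \<partial>noise_law n p \<sigma>)"
    by (simp add: likelihood_def prod.distrib[symmetric] prod_ennreal prod_nonneg)
  also have "\<dots> = (\<Prod>i=1..n. \<integral>\<^sup>+x. (\<Prod>j=1..p. ?r i j (x j)) \<partial>gaussian_law p (\<lambda>_. 0) \<sigma>)"
    unfolding signal_law_def by (rule G.product_nn_integral_prod) auto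
  also have "\<dots> = ennreal (exp (\<Sum>i=1..n. \<Sum>j=1..p. m i j * m' i j / \<sigma>\<^sup>2))"
    unfolding inner by (simp add: prod_ennreal prod_nonneg exp_sum)
  finally show ?thesis .
qed

section \<open>Sign matrices with nearly orthogonal rows\<close>

lemma cosh_le_exp_self:
  assumes "0 \<le> (a::real)"
  shows "cosh a \<le> exp a"
proof -
  have "exp (- a) \<le> exp a" using assms by simp
  then have "(exp a + exp (- a)) / 2 \<le> (exp a + exp a) / 2"
    by (intro divide_right_mono add_left_mono) auto
  then show ?thesis by (simp add: cosh_field_def)
qed

text \<open>Hoeffding's lemma for a symmetric sign.\<close>

lemma cosh_le_exp_square:
  assumes "0 \<le> (a::real)"
  shows "cosh a \<le> exp (a\<^sup>2 / 2)"
proof -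
  have "- (2 * a) * (1/2) + ln (1 + (1/2) * (exp (2 * a) - 1)) \<le> (2 * a)\<^sup>2 / 8"
    by (rule Hoeffdings_lemma_aux) (use assms in auto)
  moreover have "1 + (1/2) * (exp (2 * a) - 1) = exp a * cosh a"
    by (simp add: cosh_field_def field_simps flip: exp_add)
  ultimately have "ln (cosh a) \<le> a\<^sup>2 / 2"
    by (simp add: ln_mult power2_eq_square)
  then have "exp (ln (cosh a)) \<le> exp (a\<^sup>2 / 2)" by (rule exp_le_cancel_iff[THEN iffD2])
  then show ?thesis by simp
qed

definition signs :: "nat \<Rightarrow> (nat \<Rightarrow> real) set" where
  "signs p = {1..p} \<rightarrow>\<^sub>E {-1, 1}"

definition sign_matrices :: "nat \<Rightarrow> nat \<Rightarrow> (nat \<Rightarrow> nat \<Rightarrow> real) set" where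
  "sign_matrices K p = {1..K} \<rightarrow>\<^sub>E signs p"

lemma finite_signs [simp]: "finite (signs p)"
  unfolding signs_def by (intro finite_PiE) auto

lemma card_signs: "card (signs p) = 2 ^ p"
  unfolding signs_def by (subst card_PiE) (simp_all flip: numeral_2_eq_2)

lemma finite_sign_matrices [simp]: "finite (sign_matrices K p)"
  unfolding sign_matrices_def by (intro finite_PiE) auto

lemma card_sign_matrices: "card (sign_matrices K p) = (2 ^ p) ^ K"
  unfolding sign_matrices_def by (subst card_PiE) (auto simp: card_signs)

lemma sign_cases: "s \<in> signs p \<Longrightarrow> j \<in> {1..p} \<Longrightarrow> s j = -1 \<or> s j = 1"
  unfolding signs_def using PiE_mem by fastforce

text \<open>By symmetry the value of the fixed sign vector \<open>s\<close> does not matter: each coordinate contributes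
  \<open>exp a + exp (- a)\<close>.\<close>

lemma sum_exp_inner_signs:
  assumes "s \<in> signs p"
  shows "(\<Sum>r\<in>signs p. exp (a * (\<Sum>j=1..p. s j * r j))) = (2 * cosh a) ^ p"
proof -
  have "(\<Sum>r\<in>signs p. exp (a * (\<Sum>j=1..p. s j * r j)))
      = (\<Sum>r\<in>signs p. \<Prod>j=1..p. exp (a * (s j * r j)))"
    unfolding sum_distrib_left by (intro sum.cong refl exp_sum) auto
  also have "\<dots> = (\<Prod>j=1..p. \<Sum>t\<in>{-1, 1}. exp (a * (s j * t)))"
    unfolding signs_def by (rule prod_sum_PiE[symmetric]) auto
  also have "\<dots> = (\<Prod>j=1..p. 2 * cosh a)"
  proof (rule prod.cong[OF refl])
    fix j assume "j \<in> {1..p}"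
    with assms have "s j = -1 \<or> s j = 1" by (rule sign_cases)
    moreover have "(\<Sum>t\<in>{-1, 1}. exp (a * (s j * t))) = exp (- (a * s j)) + exp (a * s j)"
      by simp
    moreover have "2 * cosh a = exp a + exp (- a)"
      by (simp add: cosh_field_def)
    ultimately show "(\<Sum>t\<in>{-1, 1}. exp (a * (s j * t))) = 2 * cosh a"
      by (elim disjE) (simp_all only: mult_minus1_right mult_1_right minus_minus add.commute)
  qed
  also have "\<dots> = (2 * cosh a) ^ p"
    by (subst prod_constant) simp
  finally show ?thesis .
qed

lemma sum_exp_inner_sign_matrices:
  assumes "s \<in> sign_matrices K p"
  shows "(\<Sum>r\<in>sign_matrices K p. exp (\<Sum>k=1..K. a k * (\<Sum>j=1..p. s k j * r k j)))
    = real (card (sign_matrices K p)) * (\<Prod>k=1..K. cosh (a k) ^ p)"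
proof -
  have row: "s k \<in> signs p" if "k \<in> {1..K}" for k
    using assms that unfolding sign_matrices_def by (rule PiE_mem)
  have "(\<Sum>r\<in>sign_matrices K p. exp (\<Sum>k=1..K. a k * (\<Sum>j=1..p. s k j * r k j)))
      = (\<Sum>r\<in>sign_matrices K p. \<Prod>k=1..K. exp (a k * (\<Sum>j=1..p. s k j * r k j)))"
    by (intro sum.cong refl exp_sum) auto
  also have "\<dots> = (\<Prod>k=1..K. \<Sum>r\<in>signs p. exp (a k * (\<Sum>j=1..p. s k j * r j)))"
    unfolding sign_matrices_def by (rule prod_sum_PiE[symmetric]) auto
  also have "\<dots> = (\<Prod>k=1..K. 2 ^ p * cosh (a k) ^ p)"
  proof (rule prod.cong[OF refl])
    fix k assume "k \<in> {1..K}"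
    from sum_exp_inner_signs[OF row[OF this], of "a k"]
    show "(\<Sum>r\<in>signs p. exp (a k * (\<Sum>j=1..p. s k j * r j))) = 2 ^ p * cosh (a k) ^ p"
      unfolding power_mult_distrib .
  qed
  also have "\<dots> = real (card (sign_matrices K p)) * (\<Prod>k=1..K. cosh (a k) ^ p)"
    unfolding prod.distrib card_sign_matrices by (subst prod_constant) simp
  finally show ?thesis .
qed

text \<open>Freeze all rows except row \<open>l\<close>. Row \<open>k\<close> is then a fixed sign vector, so
  \<open>sum_exp_inner_signs\<close> applies to the sum over row \<open>l\<close>.\<close>

lemma sum_exp_inner_two_rows:
  assumes k: "k \<in> {1..K}" and l: "l \<in> {1..K}" and "k \<noteq> l"
  shows "(\<Sum>s\<in>sign_matrices K p. exp (a * (\<Sum>j=1..p. s k j * s l j)))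
    = real (card (sign_matrices K p)) * cosh a ^ p"
proof -
  define I where "I = {1..K} - {l}"
  have I: "{1..K} = insert l I" "l \<notin> I" "k \<in> I" "finite I" "card I = K - 1"
    using assms by (auto simp: I_def)
  have "(\<Sum>s\<in>sign_matrices K p. exp (a * (\<Sum>j=1..p. s k j * s l j)))
      = (\<Sum>(r, g)\<in>signs p \<times> (I \<rightarrow>\<^sub>E signs p). exp (a * (\<Sum>j=1..p. g k j * r j)))"
    unfolding sign_matrices_def I(1) PiE_insert_eq
    using \<open>k \<noteq> l\<close> by (subst sum.reindex[OF inj_combinator[OF I(2)]]) (auto intro!: sum.cong)
  also have "\<dots> = (\<Sum>r\<in>signs p. \<Sum>g\<in>I \<rightarrow>\<^sub>E signs p. exp (a * (\<Sum>j=1..p. g k j * r j)))"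
    by (rule sum.cartesian_product[symmetric])
  also have "\<dots> = (\<Sum>g\<in>I \<rightarrow>\<^sub>E signs p. \<Sum>r\<in>signs p. exp (a * (\<Sum>j=1..p. g k j * r j)))"
    by (rule sum.swap)
  also have "\<dots> = (\<Sum>g\<in>I \<rightarrow>\<^sub>E signs p. (2 * cosh a) ^ p)"
    using I(3) by (intro sum.cong refl sum_exp_inner_signs) (auto dest: PiE_mem)
  also have "\<dots> = (2 ^ p) ^ (K - 1) * (2 * cosh a) ^ p"
    using I by (simp add: card_PiE card_signs)
  also have "\<dots> = (2 ^ p) ^ K * cosh a ^ p"
    using k by (cases K) (auto simp: power_mult_distrib)
  finally show ?thesis by (simp add: card_sign_matrices)
qed

definition separated_sign_matrices :: "nat \<Rightarrow> nat \<Rightarrow> (nat \<Rightarrow> nat \<Rightarrow> real) set" where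
  "separated_sign_matrices K p = {s \<in> sign_matrices K p.
     \<forall>k\<in>{1..K}. \<forall>l\<in>{1..K}. k \<noteq> l \<longrightarrow> (\<Sum>j=1..p. s k j * s l j) \<le> real p / 2}"

text \<open>Chernoff bound at parameter \<open>1 / 2\<close>: the exponential moment costs \<open>exp (p / 8)\<close> and the threshold
  \<open>p / 2\<close> gains \<open>exp (- p / 4)\<close>.\<close>

lemma card_close_rows:
  assumes "k \<in> {1..K}" "l \<in> {1..K}" "k \<noteq> l"
  shows "real (card {s \<in> sign_matrices K p. real p / 2 < (\<Sum>j=1..p. s k j * s l j)})
    \<le> real (card (sign_matrices K p)) * exp (- real p / 8)" (is "real (card ?B) \<le> _")
proof -
  have "real (card ?B) = (\<Sum>s\<in>?B. 1)" by simp
  also have "\<dots> \<le> (\<Sum>s\<in>?B. exp (1/2 * (\<Sum>j=1..p. s k j * s l j) - real p / 4))"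
    by (intro sum_mono) (auto simp: field_simps)
  also have "\<dots> \<le> (\<Sum>s\<in>sign_matrices K p. exp (1/2 * (\<Sum>j=1..p. s k j * s l j) - real p / 4))"
    by (intro sum_mono2) auto
  also have "\<dots> = (\<Sum>s\<in>sign_matrices K p. exp (1/2 * (\<Sum>j=1..p. s k j * s l j))) * exp (- real p / 4)"
    by (simp add: sum_distrib_right flip: exp_add)
  also have "\<dots> = real (card (sign_matrices K p)) * (cosh (1/2) ^ p * exp (- real p / 4))"
    unfolding sum_exp_inner_two_rows[OF assms] by simp
  also have "cosh (1/2::real) ^ p \<le> exp ((1/2)\<^sup>2 / 2) ^ p"
    by (intro power_mono cosh_le_exp_square) auto
  also have "exp ((1/2)\<^sup>2 / 2) ^ p * exp (- real p / 4) = exp (- real p / 8)"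
    by (simp add: power2_eq_square flip: exp_of_nat_mult exp_add)
  finally show ?thesis by (simp add: mult_left_mono)
qed

text \<open>Union bound over the pairs of rows. There are at most \<open>K\<^sup>2\<close> of them and, as \<open>p \<ge> 24 ln K\<close>, each is close for
  a proportion at most \<open>1 / K\<^sup>3\<close> of the matrices.\<close>

lemma card_separated_sign_matrices:
  assumes K: "2 \<le> K" and p: "24 * ln (real K) \<le> real p"
  shows "real (card (sign_matrices K p)) \<le> 2 * real (card (separated_sign_matrices K p))"
proof -
  define N where "N = real (card (sign_matrices K p))"
  define P where "P = {(k, l) \<in> {1..K} \<times> {1..K}. k \<noteq> l}"
  define B where "B = (\<lambda>(k, l). {s \<in> sign_matrices K p. real p / 2 < (\<Sum>j=1..p. s k j * s l j)})"
  have P: "finite P" "card P \<le> K * K"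
  proof -
    have "P \<subseteq> {1..K} \<times> {1..K}" by (auto simp: P_def)
    from card_mono[OF _ this] finite_subset[OF this] show "finite P" "card P \<le> K * K"
      by (auto simp: card_cartesian_product)
  qed
  have "exp (- real p / 8) \<le> exp (- 3 * ln (real K))"
    using p by simp
  also have "\<dots> = 1 / real K ^ 3"
    using K by (simp add: exp_minus exp_of_nat_mult[of 3, simplified] inverse_eq_divide)
  finally have e: "exp (- real p / 8) \<le> 1 / real K ^ 3" .
  have "sign_matrices K p \<subseteq> separated_sign_matrices K p \<union> (\<Union>q\<in>P. B q)"
  proof
    fix s assume s: "s \<in> sign_matrices K p"
    show "s \<in> separated_sign_matrices K p \<union> (\<Union>q\<in>P. B q)"
    proof (cases "s \<in> separated_sign_matrices K p")
      case False
      then obtain k l where "(k, l) \<in> P" "real p / 2 < (\<Sum>j=1..p. s k j * s l j)"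
        using s unfolding separated_sign_matrices_def P_def by (auto simp: not_le)
      then have "s \<in> B (k, l)" using s by (simp add: B_def)
      then show ?thesis using \<open>(k, l) \<in> P\<close> by blast
    qed simp
  qed
  then have "card (sign_matrices K p) \<le> card (separated_sign_matrices K p \<union> (\<Union>q\<in>P. B q))"
    using P by (intro card_mono) (auto simp: separated_sign_matrices_def B_def)
  also have "\<dots> \<le> card (separated_sign_matrices K p) + (\<Sum>q\<in>P. card (B q))"
    by (rule order.trans[OF card_Un_le]) (intro add_left_mono card_UN_le P)
  finally have "N \<le> real (card (separated_sign_matrices K p)) + (\<Sum>q\<in>P. real (card (B q)))"
    unfolding N_def by (metis of_nat_add of_nat_le_iff of_nat_sum)
  also have "(\<Sum>q\<in>P. real (card (B q))) \<le> (\<Sum>q\<in>P. N * (1 / real K ^ 3))"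
  proof (intro sum_mono)
    fix q assume q: "q \<in> P"
    obtain k l where kl: "q = (k, l)" by (cases q)
    have "real (card (B q)) \<le> N * exp (- real p / 8)"
      using q unfolding kl B_def N_def prod.case
      by (intro card_close_rows) (auto simp: P_def)
    also have "\<dots> \<le> N * (1 / real K ^ 3)"
      using e by (intro mult_left_mono) (auto simp: N_def)
    finally show "real (card (B q)) \<le> N * (1 / real K ^ 3)" .
  qed
  also have "\<dots> \<le> (real K * real K) * (N * (1 / real K ^ 3))"
  proof -
    have "real (card P) \<le> real K * real K" using P(2) by (metis of_nat_le_iff of_nat_mult)
    then have "real (card P) * (N * (1 / real K ^ 3)) \<le> (real K * real K) * (N * (1 / real K ^ 3))"
      by (intro mult_right_mono) (auto simp: N_def)
    then show ?thesis by simp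
  qed
  also have "\<dots> = N / real K"
    using K by (simp add: power3_eq_cube)
  also have "\<dots> \<le> N / 2"
    using K by (intro divide_left_mono) (auto simp: N_def)
  finally show ?thesis unfolding N_def by simp
qed

section \<open>Shuffled balanced partitions\<close>

text \<open>Labels assigned cyclically to \<open>1, 2, \<dots>\<close>, so that the group sizes differ by at most one.\<close>

definition base_label :: "nat \<Rightarrow> nat \<Rightarrow> nat" where
  "base_label K i = (i - 1) mod K + 1"

lemma base_label_range: "1 \<le> K \<Longrightarrow> base_label K i \<in> {1..K}"
  using mod_less_divisor[of K "i - 1"] by (simp add: base_label_def Suc_le_eq)

lemma card_base_label:
  assumes k: "k \<in> {1..K}"
  shows "n div K \<le> card {i\<in>{1..n}. base_label K i = k}"
    and "card {i\<in>{1..n}. base_label K i = k} \<le> n div K + 1"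
proof -
  have K: "0 < K" using k by simp
  define Q where "Q = {q. q * K + k \<le> n}"
  have eq: "{i\<in>{1..n}. base_label K i = k} = (\<lambda>q. q * K + k) ` Q"
  proof (intro equalityI subsetI)
    fix i assume i: "i \<in> {i\<in>{1..n}. base_label K i = k}"
    then have "i - 1 = (i - 1) div K * K + (k - 1)"
      using div_mult_mod_eq[of "i - 1" K] by (auto simp: base_label_def)
    then have "i = (i - 1) div K * K + k" using i k by auto
    then show "i \<in> (\<lambda>q. q * K + k) ` Q" using i by (auto simp: Q_def)
  next
    fix i assume "i \<in> (\<lambda>q. q * K + k) ` Q"
    then obtain q where q: "i = q * K + k" "i \<le> n" by (auto simp: Q_def)
    have "i - 1 = (k - 1) + q * K" using q k by auto
    then have "(i - 1) mod K = (k - 1) mod K" by (simp only: mod_mult_self1)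
    moreover have "(k - 1) mod K = k - 1" using k by (intro mod_less) auto
    ultimately have "(i - 1) mod K = k - 1" by simp
    then show "i \<in> {i\<in>{1..n}. base_label K i = k}" using q k by (auto simp: base_label_def)
  qed
  have "inj_on (\<lambda>q. q * K + k) Q" using K by (auto simp: inj_on_def)
  then have card: "card {i\<in>{1..n}. base_label K i = k} = card Q"
    unfolding eq by (rule card_image)
  have sub: "Q \<subseteq> {..n div K}"
  proof
    fix q assume "q \<in> Q"
    then have "q * K \<le> n" by (simp add: Q_def)
    then show "q \<in> {..n div K}" using K by (simp add: less_eq_div_iff_mult_less_eq)
  qed
  have sup: "{..<n div K} \<subseteq> Q"
  proof
    fix q assume "q \<in> {..<n div K}"
    then have "Suc q \<le> n div K" by simp
    then have "Suc q * K \<le> n" using K by (simp only: less_eq_div_iff_mult_less_eq)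
    then show "q \<in> Q" using k by (simp add: Q_def)
  qed
  have "finite Q" using sub by (rule finite_subset) simp
  from card_mono[OF this sup] show "n div K \<le> card {i\<in>{1..n}. base_label K i = k}"
    unfolding card by simp
  from card_mono[OF _ sub] show "card {i\<in>{1..n}. base_label K i = k} \<le> n div K + 1"
    unfolding card by simp
qed

definition shuffled_groups :: "nat \<Rightarrow> nat \<Rightarrow> (nat \<Rightarrow> nat) \<Rightarrow> nat \<Rightarrow> nat set" where
  "shuffled_groups n K \<tau> = (\<lambda>k\<in>{1..K}. {i\<in>{1..n}. base_label K (\<tau> i) = k})"

lemma group_index_shuffled_groups:
  assumes "1 \<le> K" "i \<in> {1..n}"
  shows "group_index K (shuffled_groups n K \<tau>) i = base_label K (\<tau> i)"
  unfolding group_index_def shuffled_groups_def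
  using assms base_label_range[OF assms(1), of "\<tau> i"] by (intro the_equality) auto

lemma card_shuffled_label:
  assumes \<tau>: "\<tau> permutes {1..n}"
  shows "card {i\<in>{1..n}. base_label K (\<tau> i) = k} = card {i\<in>{1..n}. base_label K i = k}"
proof -
  have "\<tau> ` {i\<in>{1..n}. base_label K (\<tau> i) = k} = {i\<in>{1..n}. base_label K i = k}"
  proof (intro equalityI subsetI)
    fix x assume x: "x \<in> {i\<in>{1..n}. base_label K i = k}"
    then have "x \<in> \<tau> ` {1..n}" using permutes_image[OF \<tau>] by simp
    then obtain i where "i \<in> {1..n}" "x = \<tau> i" by auto
    then show "x \<in> \<tau> ` {i\<in>{1..n}. base_label K (\<tau> i) = k}" using x by auto
  qed (use permutes_in_image[OF \<tau>] in auto)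
  moreover have "inj_on \<tau> {i\<in>{1..n}. base_label K (\<tau> i) = k}"
    using permutes_inj[OF \<tau>] by (rule inj_on_subset) simp
  ultimately show ?thesis by (simp only: card_image[symmetric])
qed

text \<open>The sizes lie between \<open>q = n div K\<close> and \<open>q + 1\<close>. Their ratio is at most \<open>3 / 2\<close> because \<open>n \<ge> 2 K\<close> gives \<open>q \<ge> 2\<close>.\<close>

lemma shuffled_groups_balanced:
  assumes K: "1 \<le> K" and n: "2 * K \<le> n" and \<alpha>: "3 / 2 \<le> \<alpha>" and \<tau>: "\<tau> permutes {1..n}"
  shows "shuffled_groups n K \<tau> \<in> balanced_partitions n K \<alpha>"
proof -
  let ?G = "shuffled_groups n K \<tau>"
  define q where "q = n div K"
  have q: "2 \<le> q"
    unfolding q_def using K n by (simp add: less_eq_div_iff_mult_less_eq)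
  have card: "q \<le> card (?G k)" "card (?G k) \<le> q + 1" if "k \<in> {1..K}" for k
    using card_base_label[OF that, of n] that card_shuffled_label[OF \<tau>, of K k]
    unfolding q_def shuffled_groups_def by (simp_all only: restrict_apply' )
  have ne: "?G k \<noteq> {}" if "k \<in> {1..K}" for k
    using card(1)[OF that] q by auto
  have disj: "k = l" if "k \<in> {1..K}" "l \<in> {1..K}" "i \<in> ?G k" "i \<in> ?G l" for k l i
    using that by (simp add: shuffled_groups_def)
  have "?G \<in> {1..K} \<rightarrow>\<^sub>E Pow {1..n}"
    unfolding shuffled_groups_def by (intro restrict_PiE_iff[THEN iffD2]) auto
  moreover have "inj_on ?G {1..K}"
  proof (rule inj_onI)
    fix k l assume kl: "k \<in> {1..K}" "l \<in> {1..K}" "?G k = ?G l"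
    then obtain i where "i \<in> ?G k" using ne by blast
    then show "k = l" using disj kl by metis
  qed
  moreover have "partition_on {1..n} (?G ` {1..K})"
  proof (rule partition_onI)
    show "\<Union> (?G ` {1..K}) = {1..n}"
    proof (intro equalityI subsetI)
      fix i assume "i \<in> {1..n}"
      then have "i \<in> ?G (base_label K (\<tau> i))"
        using base_label_range[OF K, of "\<tau> i"] by (simp add: shuffled_groups_def)
      then show "i \<in> \<Union> (?G ` {1..K})" using base_label_range[OF K, of "\<tau> i"] by blast
    qed (auto simp: shuffled_groups_def)
    show "disjnt A B" if "A \<in> ?G ` {1..K}" "B \<in> ?G ` {1..K}" "A \<noteq> B" for A B
      using that disj unfolding disjnt_def by blast
    show "{} \<notin> ?G ` {1..K}" using ne by (metis imageE)
  qed
  ultimately have np: "?G \<in> numbered_partitions n K"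
    by (simp add: numbered_partitions_def)
  let ?C = "(\<lambda>k. card (?G k)) ` {1..K}"
  have C: "finite ?C" "?C \<noteq> {}" using K by auto
  have "Max ?C \<le> q + 1" using C card by auto
  moreover have Min: "q \<le> Min ?C" using C card by auto
  ultimately have "real (Max ?C) / real (Min ?C) \<le> (real q + 1) / real q"
    using q by (intro frac_le) auto
  also have "\<dots> \<le> 3 / 2" using q by (simp add: field_simps)
  also have "\<dots> \<le> \<alpha>" by (rule \<alpha>)
  finally show ?thesis using np by (simp add: balanced_partitions_def)
qed

section \<open>Partitions close to a given one are rare\<close>

lemma finite_numbered_partitions: "finite (numbered_partitions n K)"
proof -
  have "finite ({1..K} \<rightarrow>\<^sub>E Pow {1..n})" by (intro finite_PiE) auto
  then show ?thesis by (rule rev_finite_subset) (auto simp: numbered_partitions_def)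
qed

lemma numbered_partition_index_unique:
  assumes G: "G \<in> numbered_partitions n K"
    and "k \<in> {1..K}" "l \<in> {1..K}" "i \<in> G k" "i \<in> G l"
  shows "k = l"
proof -
  have inj: "inj_on G {1..K}" and part: "partition_on {1..n} (G ` {1..K})"
    using G by (auto simp: numbered_partitions_def)
  have "G k = G l"
    using partition_onD2[OF part] assms(2-) unfolding disjoint_def by blast
  then show ?thesis using inj assms(2,3) by (auto dest: inj_onD)
qed

text \<open>Take the permutation \<open>\<pi>\<close> that attains the minimum in the error and let \<open>B\<close> collect the points of the group \<open>k\<close>
  outside \<open>G' (\<pi> k)\<close>. An error below \<open>1 / 8\<close> leaves fewer than \<open>n / 4\<close> of them.\<close>

lemma small_clustering_error_matching:
  assumes G': "G' \<in> numbered_partitions n K" and K: "1 \<le> K" and n: "1 \<le> n"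
    and err: "clustering_error n K G' (shuffled_groups n K \<tau>) < 1 / 8"
  obtains \<pi> B where "\<pi> permutes {1..K}" "B \<subseteq> {1..n}" "4 * card B \<le> n"
    "\<And>i. i \<in> {1..n} - B \<Longrightarrow> i \<in> G' (\<pi> (base_label K (\<tau> i)))"
proof -
  let ?G = "shuffled_groups n K \<tau>"
  let ?D = "{\<Sum>k=1..K. card (sym_diff (?G k) (G' (\<pi> k))) | \<pi>. \<pi> permutes {1..K}}"
  have D: "?D = (\<lambda>\<pi>. \<Sum>k=1..K. card (sym_diff (?G k) (G' (\<pi> k)))) ` {\<pi>. \<pi> permutes {1..K}}"
    by auto
  have "Min ?D \<in> ?D"
    unfolding D using permutes_id[of "{1..K}"] by (intro Min_in finite_imageI finite_permutations) blast+
  then obtain \<pi> where \<pi>: "\<pi> permutes {1..K}"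
    and Min: "Min ?D = (\<Sum>k=1..K. card (sym_diff (?G k) (G' (\<pi> k))))" by blast
  have "4 * real (Min ?D) < real n"
    using err n by (simp add: clustering_error_def field_simps)
  then have small: "4 * (\<Sum>k=1..K. card (sym_diff (?G k) (G' (\<pi> k)))) < n"
    unfolding Min by linarith
  define B where "B = (\<Union>k\<in>{1..K}. ?G k - G' (\<pi> k))"
  have G_sub: "?G k \<subseteq> {1..n}" if "k \<in> {1..K}" for k
    using that by (auto simp: shuffled_groups_def)
  have B_sub: "B \<subseteq> {1..n}" unfolding B_def using G_sub by blast
  have fin: "finite (G' (\<pi> k))" if "k \<in> {1..K}" for k
  proof (rule finite_subset)
    have "\<pi> k \<in> {1..K}" using that permutes_in_image[OF \<pi>] by blast
    then show "G' (\<pi> k) \<subseteq> {1..n}" using G' by (auto simp: numbered_partitions_def dest: PiE_mem)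
  qed simp
  have "card B \<le> (\<Sum>k=1..K. card (?G k - G' (\<pi> k)))"
    unfolding B_def by (rule card_UN_le) simp
  also have "\<dots> \<le> (\<Sum>k=1..K. card (sym_diff (?G k) (G' (\<pi> k))))"
  proof (intro sum_mono card_mono)
    fix k assume k: "k \<in> {1..K}"
    show "finite (sym_diff (?G k) (G' (\<pi> k)))"
      using fin[OF k] finite_subset[OF G_sub[OF k]] by simp
  qed simp
  finally have "4 * card B \<le> n" using small by simp
  show ?thesis
  proof (rule that[OF \<pi> B_sub \<open>4 * card B \<le> n\<close>])
    fix i assume i: "i \<in> {1..n} - B"
    then have "i \<in> ?G (base_label K (\<tau> i))"
      using base_label_range[OF K, of "\<tau> i"] by (simp add: shuffled_groups_def)
    then show "i \<in> G' (\<pi> (base_label K (\<tau> i)))"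
      using i base_label_range[OF K, of "\<tau> i"] unfolding B_def by blast
  qed
qed

text \<open>Choose the values \<open>\<tau> i\<close> independently. A point \<open>i\<close> outside \<open>B\<close> has its label forced by \<open>\<pi>\<close> and \<open>G'\<close>, which leaves
  at most \<open>M = n div K + 1\<close> values; a point of \<open>B\<close> has at most \<open>n \<le> K M\<close> values.\<close>

lemma card_permutations_matching:
  assumes G': "G' \<in> numbered_partitions n K" and K: "1 \<le> K"
    and \<pi>: "\<pi> permutes {1..K}" and B: "B \<subseteq> {1..n}"
  shows "card {\<tau>. \<tau> permutes {1..n} \<and> (\<forall>i\<in>{1..n} - B. i \<in> G' (\<pi> (base_label K (\<tau> i))))}
    \<le> (n div K + 1) ^ n * K ^ card B" (is "card ?T \<le> _")
proof -
  define M where "M = n div K + 1"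
  define X where "X i = (if i \<in> B then {1..n} else {x\<in>{1..n}. i \<in> G' (\<pi> (base_label K x))})" for i
  have "inj_on (\<lambda>\<tau>. restrict \<tau> {1..n}) ?T"
  proof (rule inj_onI)
    fix \<tau> \<tau>' assume *: "\<tau> \<in> ?T" "\<tau>' \<in> ?T" "restrict \<tau> {1..n} = restrict \<tau>' {1..n}"
    show "\<tau> = \<tau>'"
    proof
      fix i show "\<tau> i = \<tau>' i"
      proof (cases "i \<in> {1..n}")
        case True
        then show ?thesis using fun_cong[OF *(3), of i] by (simp only: restrict_apply')
      next
        case False
        have "\<tau> permutes {1..n}" "\<tau>' permutes {1..n}" using * by blast+
        from this[THEN permutes_not_in, OF False] show ?thesis by simp
      qed
    qed
  qed
  moreover have "(\<lambda>\<tau>. restrict \<tau> {1..n}) ` ?T \<subseteq> Pi\<^sub>E {1..n} X"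
  proof (intro image_subsetI restrict_PiE_iff[THEN iffD2] ballI)
    fix \<tau> i assume \<tau>: "\<tau> \<in> ?T" and i: "i \<in> {1..n}"
    have "\<tau> i \<in> {1..n}" using \<tau> i permutes_in_image[of \<tau> "{1..n}" i] by blast
    then show "\<tau> i \<in> X i"
    proof (cases "i \<in> B")
      case False
      then have "i \<in> G' (\<pi> (base_label K (\<tau> i)))" using \<tau> i by blast
      then show ?thesis using \<open>\<tau> i \<in> {1..n}\<close> False unfolding X_def by simp
    qed (simp add: X_def)
  qed
  moreover have "finite (Pi\<^sub>E {1..n} X)"
    by (intro finite_PiE) (simp_all add: X_def)
  ultimately have "card ?T \<le> card (Pi\<^sub>E {1..n} X)"
    by (rule card_inj_on_le)
  also have "\<dots> = (\<Prod>i=1..n. card (X i))" by (simp add: card_PiE)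
  also have "\<dots> \<le> (\<Prod>i=1..n. if i \<in> B then n else M)"
  proof (intro prod_mono conjI)
    fix i assume i: "i \<in> {1..n}"
    show "card (X i) \<le> (if i \<in> B then n else M)"
    proof (cases "i \<in> B \<or> X i = {}")
      case True
      then show ?thesis
      proof
        assume "i \<in> B" then show ?thesis by (simp add: X_def)
      next
        assume "X i = {}" then show ?thesis by simp
      qed
    next
      case False
      then obtain x0 where x0: "x0 \<in> X i" by blast
      have mem: "x \<in> {1..n}" "i \<in> G' (\<pi> (base_label K x))" if "x \<in> X i" for x
        using that False unfolding X_def by simp_all
      have "X i \<subseteq> {x\<in>{1..n}. base_label K x = base_label K x0}"
      proof
        fix x assume x: "x \<in> X i"
        have in_range: "\<pi> (base_label K y) \<in> {1..K}" for y
          using base_label_range[OF K] permutes_in_image[OF \<pi>] by blast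
        have "\<pi> (base_label K x) = \<pi> (base_label K x0)"
          by (rule numbered_partition_index_unique[OF G' in_range in_range mem(2)[OF x] mem(2)[OF x0]])
        then have "base_label K x = base_label K x0"
          using permutes_inj[OF \<pi>] by (rule injD[rotated])
        then show "x \<in> {x\<in>{1..n}. base_label K x = base_label K x0}"
          using mem(1)[OF x] by simp
      qed
      then have "card (X i) \<le> card {x\<in>{1..n}. base_label K x = base_label K x0}"
        by (intro card_mono) auto
      also have "\<dots> \<le> M" unfolding M_def by (rule card_base_label(2)[OF base_label_range[OF K]])
      finally show ?thesis using False by simp
    qed
  qed simp
  also have "\<dots> = (\<Prod>i\<in>B. n) * (\<Prod>i\<in>{1..n} - B. M)"
    using B by (subst prod.subset_diff[OF B]) (auto simp: mult.commute intro!: arg_cong2[where f = "(*)"] prod.cong)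
  also have "\<dots> = n ^ card B * M ^ card ({1..n} - B)"
    by (simp only: prod_constant)
  \<comment> \<open>Writing \<open>n \<le> K M\<close> makes every point contribute a factor \<open>M\<close>, and the points of \<open>B\<close> a further \<open>K\<close>.\<close>
  also have "\<dots> \<le> (K * M) ^ card B * M ^ card ({1..n} - B)"
  proof (intro mult_right_mono power_mono)
    have "n < K * (n div K + 1)" using dividend_less_times_div[of K n] K by simp
    then show "n \<le> K * M" by (simp add: M_def)
  qed auto
  also have "\<dots> = M ^ (card B + card ({1..n} - B)) * K ^ card B"
    by (simp add: power_mult_distrib power_add)
  also have "card B + card ({1..n} - B) = n"
    using card_mono[OF _ B] unfolding card_Diff_subset[OF finite_subset[OF B finite_atLeastAtMost] B]
    by simp
  finally show ?thesis by (simp add: M_def)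
qed

text \<open>Union bound over the relabelling \<open>\<pi>\<close> and the exceptional set \<open>B\<close>.\<close>

lemma card_small_clustering_error:
  assumes G': "G' \<in> numbered_partitions n K" and K: "1 \<le> K" and n: "1 \<le> n"
  shows "card {\<tau>. \<tau> permutes {1..n} \<and> clustering_error n K G' (shuffled_groups n K \<tau>) < 1 / 8}
    \<le> fact K * 2 ^ n * ((n div K + 1) ^ n * K ^ (n div 4))" (is "card ?T \<le> _")
proof -
  define P where "P = {\<pi>. \<pi> permutes {1..K}} \<times> {B. B \<subseteq> {1..n} \<and> 4 * card B \<le> n}"
  define R where "R = (\<lambda>(\<pi>, B). {\<tau>. \<tau> permutes {1..n} \<and>
    (\<forall>i\<in>{1..n} - B. i \<in> G' (\<pi> (base_label K (\<tau> i))))})"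
  have fin_perm: "finite {\<tau>. \<tau> permutes {1..n}}" by (rule finite_permutations) simp
  have P: "finite P" "card P \<le> fact K * 2 ^ n"
  proof -
    have sub: "{B. B \<subseteq> {1..n} \<and> 4 * card B \<le> n} \<subseteq> Pow {1..n}" by auto
    then have "finite {B. B \<subseteq> {1..n} \<and> 4 * card B \<le> n}" by (rule finite_subset) simp
    then show "finite P" unfolding P_def by (intro finite_cartesian_product finite_permutations) auto
    have "card {B. B \<subseteq> {1..n} \<and> 4 * card B \<le> n} \<le> 2 ^ n"
      using card_mono[OF _ sub] by (simp add: card_Pow)
    then show "card P \<le> fact K * 2 ^ n"
      by (simp add: P_def card_cartesian_product card_permutations[of _ K])
  qed
  have "?T \<subseteq> (\<Union>q\<in>P. R q)"
  proof
    fix \<tau> assume \<tau>: "\<tau> \<in> ?T"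
    then have err: "clustering_error n K G' (shuffled_groups n K \<tau>) < 1 / 8" by simp
    obtain \<pi> B where "\<pi> permutes {1..K}" "B \<subseteq> {1..n}" "4 * card B \<le> n"
      "\<And>i. i \<in> {1..n} - B \<Longrightarrow> i \<in> G' (\<pi> (base_label K (\<tau> i)))"
      using small_clustering_error_matching[OF G' K n err] by metis
    then have "(\<pi>, B) \<in> P" "\<tau> \<in> R (\<pi>, B)" using \<tau> by (auto simp: P_def R_def)
    then show "\<tau> \<in> (\<Union>q\<in>P. R q)" by blast
  qed
  then have "card ?T \<le> card (\<Union>q\<in>P. R q)"
    using P fin_perm by (intro card_mono finite_UN_I) (auto simp: R_def intro: rev_finite_subset)
  also have "\<dots> \<le> (\<Sum>q\<in>P. card (R q))" by (rule card_UN_le[OF P(1)])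
  also have "\<dots> \<le> (\<Sum>q\<in>P. (n div K + 1) ^ n * K ^ (n div 4))"
  proof (rule sum_mono)
    fix q assume "q \<in> P"
    then obtain \<pi> B where q: "q = (\<pi>, B)" "\<pi> permutes {1..K}" "B \<subseteq> {1..n}" "4 * card B \<le> n"
      by (auto simp: P_def)
    have "card (R q) \<le> (n div K + 1) ^ n * K ^ card B"
      unfolding q(1) R_def prod.case by (rule card_permutations_matching[OF G' K q(2,3)])
    also have "\<dots> \<le> (n div K + 1) ^ n * K ^ (n div 4)"
      using q(4) K by (intro mult_left_mono power_increasing) auto
    finally show "card (R q) \<le> (n div K + 1) ^ n * K ^ (n div 4)" .
  qed
  also have "\<dots> \<le> fact K * 2 ^ n * ((n div K + 1) ^ n * K ^ (n div 4))"
    using P(2) by (simp add: mult_right_mono)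
  finally show ?thesis .
qed

lemma power_self_le_exp_fact: "real n ^ n \<le> exp (real n) * fact n"
proof -
  have "(\<Sum>k\<in>{n}. real n ^ k /\<^sub>R fact k) \<le> (\<Sum>k. real n ^ k /\<^sub>R fact k)"
    using exp_converges[of "real n"] by (intro sum_le_suminf) (auto simp: sums_iff)
  also have "\<dots> = exp (real n)" using exp_converges[of "real n"] by (simp add: sums_iff)
  finally show ?thesis by (simp add: field_simps)
qed

text \<open>With \<open>M \<le> 3 n / (2 K)\<close> and \<open>n! \<ge> (n / 3)^n\<close>, the factor \<open>2^n M^n / n!\<close> is at most \<open>(9 / K)^n\<close>. The factors \<open>K!\<close> and
  \<open>K ^ (n div 4)\<close> give back at most the powers \<open>n / 2\<close> and \<open>n / 4\<close> of \<open>K\<close>, and the power \<open>- n / 4\<close> remains.\<close>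

lemma small_clustering_error_rare:
  assumes G': "G' \<in> numbered_partitions n K" and K: "1 \<le> K" and n: "2 * K \<le> n"
  shows "real (card {\<tau>. \<tau> permutes {1..n} \<and> clustering_error n K G' (shuffled_groups n K \<tau>) < 1 / 8})
    \<le> fact n * 9 ^ n * exp (- (real n * ln (real K) / 4))" (is "real (card ?T) \<le> _")
proof -
  have n1: "1 \<le> n" and K0: "0 < real K" and n0: "0 < real n" using K n by auto
  have pow: "real K ^ m \<le> exp (real n * ln (real K) * c)" if "real m \<le> real n * c" for m c
  proof -
    have "real K ^ m = exp (real m * ln (real K))" using K0 by (simp add: exp_of_nat_mult)
    also have "\<dots> \<le> exp ((real n * c) * ln (real K))"
      using that K by (subst exp_le_cancel_iff, intro mult_right_mono) auto
    finally show ?thesis by (simp add: mult_ac)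
  qed
  have M: "real (n div K + 1) \<le> 3 * real n / (2 * real K)"
  proof -
    have "1 \<le> real n / (2 * real K)" using n K0 by (simp add: field_simps flip: of_nat_mult)
    moreover have "3 * real n / (2 * real K) = real n / real K + real n / (2 * real K)"
      using K0 by (simp add: field_simps)
    moreover have "real (n div K) \<le> real n / real K" by (rule of_nat_div_le_of_nat)
    ultimately show ?thesis by simp
  qed
  have "fact K \<le> real K ^ K" using fact_le_power[of K, where 'a = real] by simp
  also have "\<dots> \<le> exp (real n * ln (real K) * (1/2))" using n by (intro pow) simp
  finally have factK: "fact K \<le> exp (real n * ln (real K) * (1/2))" .
  have quarter: "real K ^ (n div 4) \<le> exp (real n * ln (real K) * (1/4))"
    using of_nat_div_le_of_nat[of n 4] by (intro pow) simp
  have "real n ^ n \<le> exp (real n) * fact n" by (rule power_self_le_exp_fact)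
  also have "exp (real n) \<le> 3 ^ n"
    using exp_le by (simp add: exp_of_nat_mult[of n 1, simplified] power_mono)
  finally have nn: "real n ^ n \<le> 3 ^ n * fact n" by simp
  have "real (card ?T) \<le> real (fact K * 2 ^ n * ((n div K + 1) ^ n * K ^ (n div 4)))"
    using card_small_clustering_error[OF G' K n1] by (simp only: of_nat_le_iff)
  also have "\<dots> = fact K * 2 ^ n * (real (n div K + 1) ^ n * real K ^ (n div 4))" by simp
  also have "\<dots> \<le> exp (real n * ln (real K) * (1/2)) * 2 ^ n *
      ((3 * real n / (2 * real K)) ^ n * exp (real n * ln (real K) * (1/4)))"
    by (intro mult_mono factK M quarter power_mono) auto
  also have "\<dots> = exp (real n * ln (real K) * (3/4)) * (3 ^ n * real n ^ n / real K ^ n)"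
  proof -
    have "exp (real n * ln (real K) * (3/4)) =
        exp (real n * ln (real K) * (1/2)) * exp (real n * ln (real K) * (1/4))"
      by (simp flip: exp_add)
    then show ?thesis by (simp add: power_mult_distrib power_divide)
  qed
  also have "\<dots> \<le> exp (real n * ln (real K) * (3/4)) * (3 ^ n * (3 ^ n * fact n) / real K ^ n)"
    by (intro mult_left_mono divide_right_mono nn) auto
  also have "\<dots> = fact n * 9 ^ n * (exp (real n * ln (real K) * (3/4)) / real K ^ n)"
    by (simp flip: power_mult_distrib)
  also have "real K ^ n = exp (real n * ln (real K))" using K0 by (simp add: exp_of_nat_mult)
  also have "exp (real n * ln (real K) * (3/4)) / exp (real n * ln (real K))
      = exp (- (real n * ln (real K) / 4))"
    by (simp flip: exp_diff)
  finally show ?thesis .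
qed

section \<open>Second moment method for testing\<close>

text \<open>Each hypothesis \<open>t\<close> is tested through the uniform mixture over \<open>s\<close>, with likelihood ratio \<open>X\<close> against \<open>Q\<close>. On the
  event \<open>A t\<close> one has \<open>X \<le> X\<^sup>2 / (4 V) + V\<close>, so the mixture gives \<open>A t\<close> probability at most
  \<open>1 / 4 + V Q(A t)\<close>. The average over \<open>t\<close> of \<open>Q(A t)\<close> is at most \<open>1 / (8 V)\<close> because, by \<open>rare\<close>, no
  observation lies in many of the events. So the average over \<open>t\<close> and \<open>s\<close> of the probability of \<open>A t\<close> is at most \<open>3 / 8\<close>.\<close>

lemma exists_hard_hypothesis:
  fixes Q :: "'a measure" and L :: "'t \<Rightarrow> 's \<Rightarrow> 'a \<Rightarrow> real"
  assumes Q: "prob_space Q"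
    and T: "finite T" "T \<noteq> {}" and S: "finite S" "S \<noteq> {}"
    and meas: "\<And>t s. t \<in> T \<Longrightarrow> s \<in> S \<Longrightarrow> L t s \<in> borel_measurable Q"
    and nonneg: "\<And>t s y. t \<in> T \<Longrightarrow> s \<in> S \<Longrightarrow> 0 \<le> L t s y"
    and prob: "\<And>t s. t \<in> T \<Longrightarrow> s \<in> S \<Longrightarrow> prob_space (density Q (\<lambda>y. ennreal (L t s y)))"
    and A: "\<And>t. t \<in> T \<Longrightarrow> A t \<in> sets Q"
    and V: "0 < V"
    and moment: "\<And>t. t \<in> T \<Longrightarrow>
      (\<integral>\<^sup>+y. ennreal ((\<Sum>s\<in>S. L t s y)\<^sup>2) \<partial>Q) \<le> ennreal (V * (real (card S))\<^sup>2)"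
    and rare: "\<And>y. y \<in> space Q \<Longrightarrow> real (card {t \<in> T. y \<in> A t}) \<le> real (card T) / (8 * V)"
  shows "\<exists>t\<in>T. \<exists>s\<in>S. measure (density Q (\<lambda>y. ennreal (L t s y))) (A t) \<le> 3 / 8"
proof (rule ccontr)
  interpret Q: prob_space Q by fact
  define P where "P t s = measure (density Q (\<lambda>y. ennreal (L t s y))) (A t)" for t s
  define c where "c = V * real (card S)"
  assume "\<not> ?thesis"
  then have large: "3 / 8 < P t s" if "t \<in> T" "s \<in> S" for t s
    using that by (auto simp: P_def not_le)
  have card_pos: "0 < real (card S)" "0 < real (card T)"
    using T S by (auto simp: card_gt_0_iff)
  have c: "0 < c" using V card_pos by (simp add: c_def)
  \<comment> \<open>Here \<open>u\<close> is the sum, not the average, of the likelihood ratios, so \<open>V\<close> is scaled to \<open>c\<close>.\<close>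
  have AM_GM: "u * b \<le> u\<^sup>2 / (4 * c) + c * b" if "b = 0 \<or> b = 1" for u b :: real
  proof -
    have "0 \<le> (u - 2 * c)\<^sup>2 / (4 * c)" using c by simp
    also have "\<dots> = u\<^sup>2 / (4 * c) + c - u" using c by (simp add: power2_eq_square field_simps)
    finally show ?thesis using that c by auto
  qed
  have bound: "(\<Sum>s\<in>S. P t s) \<le> real (card S) / 4 + c * measure Q (A t)" if t: "t \<in> T" for t
  proof -
    note [measurable] = meas[OF t] A[OF t]
    have "ennreal (\<Sum>s\<in>S. P t s) = (\<Sum>s\<in>S. ennreal (P t s))"
      by (simp add: P_def)
    also have "\<dots> = (\<Sum>s\<in>S. \<integral>\<^sup>+y. ennreal (L t s y) * indicator (A t) y \<partial>Q)"
    proof (rule sum.cong[OF refl])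
      fix s assume s: "s \<in> S"
      interpret D: prob_space "density Q (\<lambda>y. ennreal (L t s y))" by (rule prob[OF t s])
      have "ennreal (P t s) = emeasure (density Q (\<lambda>y. ennreal (L t s y))) (A t)"
        by (simp add: P_def D.emeasure_eq_measure)
      also have "\<dots> = (\<integral>\<^sup>+y. ennreal (L t s y) * indicator (A t) y \<partial>Q)"
        using meas[OF t s] by (intro emeasure_density) auto
      finally show "ennreal (P t s) = (\<integral>\<^sup>+y. ennreal (L t s y) * indicator (A t) y \<partial>Q)" .
    qed
    also have "\<dots> = (\<integral>\<^sup>+y. (\<Sum>s\<in>S. ennreal (L t s y) * indicator (A t) y) \<partial>Q)"
      by (rule nn_integral_sum[symmetric]) measurable
    also have "\<dots> = (\<integral>\<^sup>+y. ennreal ((\<Sum>s\<in>S. L t s y) * indicator (A t) y) \<partial>Q)"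
    proof (rule nn_integral_cong)
      fix y
      show "(\<Sum>s\<in>S. ennreal (L t s y) * indicator (A t) y)
          = ennreal ((\<Sum>s\<in>S. L t s y) * indicator (A t) y)"
        using nonneg[OF t] by (cases "y \<in> A t") (auto simp: sum_ennreal)
    qed
    also have "\<dots> \<le> (\<integral>\<^sup>+y. ennreal (1 / (4 * c)) * ennreal ((\<Sum>s\<in>S. L t s y)\<^sup>2)
        + ennreal c * indicator (A t) y \<partial>Q)"
    proof (rule nn_integral_mono)
      fix y
      have "ennreal ((\<Sum>s\<in>S. L t s y) * indicator (A t) y)
          \<le> ennreal ((\<Sum>s\<in>S. L t s y)\<^sup>2 / (4 * c) + c * indicator (A t) y)"
        by (intro ennreal_leI AM_GM) (auto simp: indicator_def)
      also have "\<dots> = ennreal (1 / (4 * c)) * ennreal ((\<Sum>s\<in>S. L t s y)\<^sup>2) + ennreal c * indicator (A t) y"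
        using c by (simp add: ennreal_plus ennreal_mult'[symmetric] ennreal_indicator[symmetric] del: ennreal_indicator)
      finally show "ennreal ((\<Sum>s\<in>S. L t s y) * indicator (A t) y)
          \<le> ennreal (1 / (4 * c)) * ennreal ((\<Sum>s\<in>S. L t s y)\<^sup>2) + ennreal c * indicator (A t) y" .
    qed
    also have "\<dots> = ennreal (1 / (4 * c)) * (\<integral>\<^sup>+y. ennreal ((\<Sum>s\<in>S. L t s y)\<^sup>2) \<partial>Q)
        + ennreal c * emeasure Q (A t)"
      by (subst nn_integral_add) (auto simp: nn_integral_cmult)
    also have "\<dots> \<le> ennreal (1 / (4 * c)) * ennreal (V * (real (card S))\<^sup>2) + ennreal c * emeasure Q (A t)"
      by (intro add_right_mono mult_left_mono moment t) simp
    also have "\<dots> = ennreal (1 / (4 * c) * (V * (real (card S))\<^sup>2) + c * measure Q (A t))"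
      unfolding Q.emeasure_eq_measure using c V by (simp add: ennreal_mult'[symmetric] flip: ennreal_plus)
    also have "1 / (4 * c) * (V * (real (card S))\<^sup>2) = real (card S) / 4"
      using V card_pos by (simp add: c_def power2_eq_square)
    finally show ?thesis
      using c by (subst (asm) ennreal_le_iff) auto
  qed
  have "(\<Sum>t\<in>T. measure Q (A t)) \<le> real (card T) / (8 * V)"
  proof -
    have "ennreal (\<Sum>t\<in>T. measure Q (A t)) = (\<Sum>t\<in>T. \<integral>\<^sup>+y. indicator (A t) y \<partial>Q)"
      using A by (simp add: Q.emeasure_eq_measure[symmetric] flip: sum_ennreal)
    also have "\<dots> = (\<integral>\<^sup>+y. (\<Sum>t\<in>T. indicator (A t) y) \<partial>Q)"
      using A by (intro nn_integral_sum[symmetric]) auto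
    also have "\<dots> \<le> (\<integral>\<^sup>+y. ennreal (real (card T) / (8 * V)) \<partial>Q)"
    proof (rule nn_integral_mono)
      fix y assume y: "y \<in> space Q"
      have "(\<Sum>t\<in>T. indicator (A t) y) = (of_nat (card {t \<in> T. y \<in> A t}) :: ennreal)"
        using T by (simp add: indicator_def sum.If_cases Int_def)
      also have "\<dots> = ennreal (real (card {t \<in> T. y \<in> A t}))"
        by (simp add: ennreal_of_nat_eq_real_of_nat)
      also have "\<dots> \<le> ennreal (real (card T) / (8 * V))" by (intro ennreal_leI rare y)
      finally show "(\<Sum>t\<in>T. indicator (A t) y) \<le> ennreal (real (card T) / (8 * V))" .
    qed
    also have "\<dots> = ennreal (real (card T) / (8 * V))" by (simp add: Q.emeasure_space_1)
    finally show ?thesis using V by (subst (asm) ennreal_le_iff) auto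
  qed
  then have "c * (\<Sum>t\<in>T. measure Q (A t)) \<le> c * (real (card T) / (8 * V))"
    using c by (intro mult_left_mono) auto
  also have "\<dots> = real (card T) * real (card S) / 8" using V by (simp add: c_def)
  finally have tail: "c * (\<Sum>t\<in>T. measure Q (A t)) \<le> real (card T) * real (card S) / 8" .
  have "real (card T) * (real (card S) * (3 / 8)) = (\<Sum>t\<in>T. \<Sum>s\<in>S. 3 / 8)" by simp
  also have "\<dots> < (\<Sum>t\<in>T. \<Sum>s\<in>S. P t s)"
    using T S large by (intro sum_strict_mono) auto
  also have "\<dots> \<le> (\<Sum>t\<in>T. real (card S) / 4 + c * measure Q (A t))"
    by (intro sum_mono bound)
  also have "\<dots> = real (card T) * real (card S) / 4 + c * (\<Sum>t\<in>T. measure Q (A t))"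
    by (simp add: sum.distrib sum_distrib_left)
  also have "\<dots> \<le> real (card T) * real (card S) / 4 + real (card T) * real (card S) / 8"
    using tail by (intro add_left_mono)
  finally show False by simp
qed

section \<open>The Bayesian experiment\<close>

definition scaled_means :: "nat \<Rightarrow> nat \<Rightarrow> real \<Rightarrow> (nat \<Rightarrow> nat \<Rightarrow> real) \<Rightarrow> nat \<Rightarrow> nat \<Rightarrow> real" where
  "scaled_means p K h s = (\<lambda>k\<in>{1..K}. \<lambda>j\<in>{1..p}. h * s k j)"

lemma sample_law_shuffled:
  assumes "1 \<le> K"
  shows "sample_law n p K \<sigma> (scaled_means p K h s) (shuffled_groups n K \<tau>)
    = signal_law n p \<sigma> (\<lambda>i j. h * s (base_label K (\<tau> i)) j)"
  unfolding sample_law_def signal_law_def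
proof (rule PiM_cong[OF refl])
  fix i assume "i \<in> {1..n}"
  then have "scaled_means p K h s (group_index K (shuffled_groups n K \<tau>) i)
      = (\<lambda>j\<in>{1..p}. h * s (base_label K (\<tau> i)) j)"
    using base_label_range[OF assms, of "\<tau> i"]
    by (simp add: group_index_shuffled_groups[OF assms] scaled_means_def)
  then show "gaussian_law p (scaled_means p K h s (group_index K (shuffled_groups n K \<tau>) i)) \<sigma>
      = gaussian_law p (\<lambda>j. h * s (base_label K (\<tau> i)) j) \<sigma>"
    unfolding gaussian_law_def by (intro PiM_cong) auto
qed

text \<open>Two rows with inner product at most \<open>p / 2\<close> are at squared distance \<open>2 p - 2 \<langle>s\<^sub>r, s\<^sub>l\<rangle> \<ge> p\<close>.\<close>

lemma scaled_means_separated: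
  assumes s: "s \<in> separated_sign_matrices K p" and p: "1 \<le> p" and \<sigma>: "0 < \<sigma>"
    and h: "h\<^sup>2 = 2 * \<sigma>\<^sup>2 * \<Delta>\<^sup>2 / real p"
  shows "scaled_means p K h s \<in> separated_means p K \<sigma> \<Delta>"
  unfolding separated_means_def mem_Collect_eq
proof (intro conjI ballI impI)
  show "scaled_means p K h s \<in> {1..K} \<rightarrow>\<^sub>E ({1..p} \<rightarrow>\<^sub>E UNIV)"
    unfolding scaled_means_def by (intro restrict_PiE_iff[THEN iffD2] ballI) auto
next
  fix l r assume lr: "l \<in> {1..K}" "r \<in> {1..K}" "l \<noteq> r"
  have row: "(s k j)\<^sup>2 = 1" if "k \<in> {1..K}" "j \<in> {1..p}" for k j
  proof -
    have "s k \<in> signs p"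
      using s that(1) by (auto simp: separated_sign_matrices_def sign_matrices_def dest: PiE_mem)
    then show ?thesis using sign_cases[OF _ that(2), of "s k"] by auto
  qed
  have "(L2_set (\<lambda>j. scaled_means p K h s r j - scaled_means p K h s l j) {1..p})\<^sup>2
      = (\<Sum>j=1..p. (h * s r j - h * s l j)\<^sup>2)"
    using lr by (simp add: L2_set_def sum_nonneg scaled_means_def)
  also have "\<dots> = (\<Sum>j=1..p. h\<^sup>2 * (2 - 2 * (s r j * s l j)))"
  proof (rule sum.cong[OF refl])
    fix j assume "j \<in> {1..p}"
    have "(h * s r j - h * s l j)\<^sup>2 = h\<^sup>2 * ((s r j)\<^sup>2 + (s l j)\<^sup>2 - 2 * (s r j * s l j))"
      by (simp add: power2_eq_square algebra_simps)
    then show "(h * s r j - h * s l j)\<^sup>2 = h\<^sup>2 * (2 - 2 * (s r j * s l j))"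
      using row[OF lr(1) \<open>j \<in> _\<close>] row[OF lr(2) \<open>j \<in> _\<close>] by simp
  qed
  also have "\<dots> = h\<^sup>2 * (2 * real p - 2 * (\<Sum>j=1..p. s r j * s l j))"
    by (simp add: sum_subtractf flip: sum_distrib_left)
  finally have norm: "(L2_set (\<lambda>j. scaled_means p K h s r j - scaled_means p K h s l j) {1..p})\<^sup>2
      = h\<^sup>2 * (2 * real p - 2 * (\<Sum>j=1..p. s r j * s l j))" .
  have "(\<Sum>j=1..p. s r j * s l j) \<le> real p / 2"
    using s lr by (auto simp: separated_sign_matrices_def)
  then have "h\<^sup>2 * real p \<le> h\<^sup>2 * (2 * real p - 2 * (\<Sum>j=1..p. s r j * s l j))"
    by (intro mult_left_mono) auto
  then show "\<Delta>\<^sup>2 \<le> (L2_set (\<lambda>j. scaled_means p K h s r j - scaled_means p K h s l j) {1..p})\<^sup>2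
      / (2 * \<sigma>\<^sup>2)"
    unfolding norm using p \<sigma> by (simp add: h field_simps)
qed

text \<open>The overlap of the mean matrices for \<open>s\<close> and \<open>r\<close> is a weighted sum of the inner products of their rows,
  with the group sizes as weights. For fixed \<open>s\<close>, enlarging the sum over \<open>r\<close> from separated to all sign matrices makes it
  factorise, and costs only the factor 2 of \<open>card_separated_sign_matrices\<close>.\<close>

lemma second_moment_mixture:
  assumes \<sigma>: "0 < \<sigma>" and K: "2 \<le> K" and p: "24 * ln (real K) \<le> real p"
    and \<tau>: "\<tau> permutes {1..n}"
  defines "S \<equiv> separated_sign_matrices K p"
    and "g \<equiv> \<lambda>i. base_label K (\<tau> i)"
  shows "(\<integral>\<^sup>+y. ennreal ((\<Sum>s\<in>S. likelihood n p \<sigma> (\<lambda>i j. \<sigma> * \<epsilon> * s (g i) j) y)\<^sup>2) \<partial>noise_law n p \<sigma>)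
    \<le> ennreal (2 * (\<Prod>k=1..K. cosh (\<epsilon>\<^sup>2 * real (card {i\<in>{1..n}. base_label K i = k})) ^ p)
        * (real (card S))\<^sup>2)"
proof -
  let ?m = "\<lambda>s i j. \<sigma> * \<epsilon> * s (g i) j"
  let ?lik = "\<lambda>s y. likelihood n p \<sigma> (?m s) y"
  let ?a = "\<lambda>k. \<epsilon>\<^sup>2 * real (card {i\<in>{1..n}. base_label K i = k})"
  define W where "W = (\<Prod>k=1..K. cosh (?a k) ^ p)"
  have W: "0 \<le> W" unfolding W_def by (intro prod_nonneg) auto
  have S: "finite S" "S \<subseteq> sign_matrices K p"
  proof -
    show "S \<subseteq> sign_matrices K p" by (auto simp: S_def separated_sign_matrices_def)
    then show "finite S" by (rule finite_subset) simp
  qed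
  have g: "g ` {1..n} \<subseteq> {1..K}" using base_label_range[of K] K by (auto simp: g_def)
  have overlap: "(\<Sum>i=1..n. \<Sum>j=1..p. ?m s i j * ?m r i j / \<sigma>\<^sup>2)
      = (\<Sum>k=1..K. ?a k * (\<Sum>j=1..p. s k j * r k j))" for s r :: "nat \<Rightarrow> nat \<Rightarrow> real"
  proof -
    have "(\<Sum>i=1..n. \<Sum>j=1..p. ?m s i j * ?m r i j / \<sigma>\<^sup>2)
        = (\<Sum>i=1..n. \<epsilon>\<^sup>2 * (\<Sum>j=1..p. s (g i) j * r (g i) j))"
      unfolding sum_distrib_left using \<sigma>
      by (intro sum.cong refl) (simp add: power2_eq_square field_simps)
    also have "\<dots> = (\<Sum>k=1..K. \<Sum>i | i \<in> {1..n} \<and> g i = k. \<epsilon>\<^sup>2 * (\<Sum>j=1..p. s (g i) j * r (g i) j))"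
      by (rule sum.group[OF _ _ g, symmetric]) auto
    also have "\<dots> = (\<Sum>k=1..K. ?a k * (\<Sum>j=1..p. s k j * r k j))"
    proof (rule sum.cong[OF refl])
      fix k
      have "(\<Sum>i | i \<in> {1..n} \<and> g i = k. \<epsilon>\<^sup>2 * (\<Sum>j=1..p. s (g i) j * r (g i) j))
          = (\<Sum>i | i \<in> {1..n} \<and> g i = k. \<epsilon>\<^sup>2 * (\<Sum>j=1..p. s k j * r k j))"
        by (rule sum.cong) auto
      also have "\<dots> = real (card {i\<in>{1..n}. g i = k}) * (\<epsilon>\<^sup>2 * (\<Sum>j=1..p. s k j * r k j))"
        by (rule sum_constant)
      also have "card {i\<in>{1..n}. g i = k} = card {i\<in>{1..n}. base_label K i = k}"
        unfolding g_def by (rule card_shuffled_label[OF \<tau>])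
      finally show "(\<Sum>i | i \<in> {1..n} \<and> g i = k. \<epsilon>\<^sup>2 * (\<Sum>j=1..p. s (g i) j * r (g i) j))
          = ?a k * (\<Sum>j=1..p. s k j * r k j)" by (simp only: mult_ac)
    qed
    finally show ?thesis .
  qed
  have meas [measurable]: "?lik s \<in> borel_measurable (noise_law n p \<sigma>)" for s
    using borel_measurable_likelihood by (simp cong: measurable_cong_sets add: sets_signal_law)
  have "(\<integral>\<^sup>+y. ennreal ((\<Sum>s\<in>S. ?lik s y)\<^sup>2) \<partial>noise_law n p \<sigma>)
      = (\<integral>\<^sup>+y. (\<Sum>s\<in>S. \<Sum>r\<in>S. ennreal (?lik s y * ?lik r y)) \<partial>noise_law n p \<sigma>)"
    by (simp add: power2_eq_square sum_product sum_nonneg likelihood_nonneg)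
  also have "\<dots> = (\<Sum>s\<in>S. \<Sum>r\<in>S. \<integral>\<^sup>+y. ennreal (?lik s y * ?lik r y) \<partial>noise_law n p \<sigma>)"
    by (simp add: nn_integral_sum)
  also have "\<dots> = ennreal (\<Sum>s\<in>S. \<Sum>r\<in>S. exp (\<Sum>k=1..K. ?a k * (\<Sum>j=1..p. s k j * r k j)))"
    unfolding second_moment_likelihood[OF \<sigma>] overlap by (simp add: sum_nonneg)
  also have "\<dots> \<le> ennreal (2 * W * (real (card S))\<^sup>2)"
  proof (rule ennreal_leI)
    have "(\<Sum>s\<in>S. \<Sum>r\<in>S. exp (\<Sum>k=1..K. ?a k * (\<Sum>j=1..p. s k j * r k j)))
        \<le> (\<Sum>s\<in>S. \<Sum>r\<in>sign_matrices K p. exp (\<Sum>k=1..K. ?a k * (\<Sum>j=1..p. s k j * r k j)))"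
      using S by (intro sum_mono sum_mono2) auto
    also have "\<dots> = (\<Sum>s\<in>S. real (card (sign_matrices K p)) * W)"
      unfolding W_def using S by (intro sum.cong refl sum_exp_inner_sign_matrices) auto
    also have "\<dots> = real (card S) * (real (card (sign_matrices K p)) * W)" by (rule sum_constant)
    also have "\<dots> \<le> real (card S) * ((2 * real (card S)) * W)"
      unfolding S_def using W by (intro mult_left_mono mult_right_mono card_separated_sign_matrices[OF K p]) auto
    finally show "(\<Sum>s\<in>S. \<Sum>r\<in>S. exp (\<Sum>k=1..K. ?a k * (\<Sum>j=1..p. s k j * r k j)))
        \<le> 2 * W * (real (card S))\<^sup>2" by (simp only: power2_eq_square mult_ac)
  qed
  finally show ?thesis unfolding W_def .
qed

text \<open>If \<open>\<Delta>\<^sup>2\<close> is at most a constant times \<open>ln K\<close>, the linear bound on \<open>ln cosh\<close> gives the exponent \<open>2 n \<Delta>\<^sup>2\<close>. Otherwise the quadratic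
  bound gives \<open>2 \<Delta>^4 / p\<close> times the sum of the squared group sizes, which is of order \<open>n\<^sup>2 / K\<close>.\<close>

lemma prod_cosh_le:
  fixes \<Delta> :: real
  assumes K: "2 \<le> K" and n: "2 * K \<le> n" and p: "1 \<le> p"
    and \<epsilon>: "\<epsilon>\<^sup>2 = 2 * \<Delta>\<^sup>2 / real p"
    and \<Delta>: "\<Delta>\<^sup>2 \<le> 1 / 24 * max (ln (real K)) (sqrt (real p * real K * ln (real K) / real n))"
  shows "(\<Prod>k=1..K. cosh (\<epsilon>\<^sup>2 * real (card {i\<in>{1..n}. base_label K i = k})) ^ p)
    \<le> exp (real n * ln (real K) / 8)"
proof -
  define m where "m k = real (card {i\<in>{1..n}. base_label K i = k})" for k
  have m0: "0 \<le> m k" for k by (simp add: m_def)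
  have pos: "0 < real K" "0 < real n" "0 < real p" "0 < ln (real K)" using K n p by auto
  have sum_m: "(\<Sum>k=1..K. m k) = real n"
  proof -
    have "base_label K ` {1..n} \<subseteq> {1..K}" using base_label_range[of K] K by auto
    from sum.group[OF _ _ this, of "\<lambda>_. 1::nat"]
    have "(\<Sum>k=1..K. card {i\<in>{1..n}. base_label K i = k}) = card {1..n}" by simp
    then show ?thesis unfolding m_def by (simp flip: of_nat_sum)
  qed
  have m_le: "m k \<le> 3 * real n / (2 * real K)" if "k \<in> {1..K}" for k
  proof -
    have "1 \<le> real n / (2 * real K)" using n pos by (simp add: field_simps flip: of_nat_mult)
    moreover have "3 * real n / (2 * real K) = real n / real K + real n / (2 * real K)"
      using pos by (simp add: field_simps)
    moreover have "real (n div K) \<le> real n / real K" by (rule of_nat_div_le_of_nat)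
    moreover have "m k \<le> real (n div K + 1)"
      unfolding m_def using card_base_label(2)[OF that, of n] by (simp only: of_nat_le_iff)
    ultimately show ?thesis by simp
  qed
  have cosh_le: "(\<Prod>k=1..K. cosh (\<epsilon>\<^sup>2 * m k) ^ p) \<le> exp (\<Sum>k=1..K. real p * b k)"
    if "\<And>k. cosh (\<epsilon>\<^sup>2 * m k) \<le> exp (b k)" for b
  proof -
    have "(\<Prod>k=1..K. cosh (\<epsilon>\<^sup>2 * m k) ^ p) \<le> (\<Prod>k=1..K. exp (b k) ^ p)"
      using that by (intro prod_mono conjI power_mono zero_le_power) (auto intro: cosh_real_nonneg)
    also have "\<dots> = exp (\<Sum>k=1..K. real p * b k)"
      by (subst exp_sum) (simp_all add: exp_of_nat_mult)
    finally show ?thesis .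
  qed
  have "(\<Prod>k=1..K. cosh (\<epsilon>\<^sup>2 * m k) ^ p) \<le> exp (real n * ln (real K) / 8)"
  proof (cases "\<Delta>\<^sup>2 \<le> 1 / 24 * ln (real K)")
    case True
    have "(\<Prod>k=1..K. cosh (\<epsilon>\<^sup>2 * m k) ^ p) \<le> exp (\<Sum>k=1..K. real p * (\<epsilon>\<^sup>2 * m k))"
      using m0 by (intro cosh_le cosh_le_exp_self mult_nonneg_nonneg) auto
    also have "(\<Sum>k=1..K. real p * (\<epsilon>\<^sup>2 * m k)) = 2 * \<Delta>\<^sup>2 * real n"
      using pos unfolding sum_distrib_left[symmetric] sum_m \<epsilon> by simp
    also have "exp (2 * \<Delta>\<^sup>2 * real n) \<le> exp (real n * ln (real K) / 8)"
    proof -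
      have "2 * \<Delta>\<^sup>2 * real n \<le> 2 * (1 / 24 * ln (real K)) * real n"
        using True by (intro mult_left_mono mult_right_mono) auto
      also have "\<dots> \<le> real n * ln (real K) / 8" using pos by simp
      finally show ?thesis by simp
    qed
    finally show ?thesis .
  next
    case False
    define R where "R = real p * real K * ln (real K) / real n"
    have R: "0 \<le> R" using pos by (simp add: R_def)
    have "\<Delta>\<^sup>2 \<le> 1 / 24 * sqrt R" using \<Delta> False unfolding R_def[symmetric] by (auto simp: max_def split: if_splits)
    then have "(\<Delta>\<^sup>2)\<^sup>2 \<le> (1 / 24 * sqrt R)\<^sup>2" by (intro power_mono) auto
    also have "\<dots> = (1 / 24)\<^sup>2 * R" unfolding power_mult_distrib using R by simp
    finally have \<Delta>4: "(\<Delta>\<^sup>2)\<^sup>2 \<le> (1 / 24)\<^sup>2 * R" .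
    have "(\<Prod>k=1..K. cosh (\<epsilon>\<^sup>2 * m k) ^ p) \<le> exp (\<Sum>k=1..K. real p * ((\<epsilon>\<^sup>2 * m k)\<^sup>2 / 2))"
      using m0 by (intro cosh_le cosh_le_exp_square mult_nonneg_nonneg) auto
    also have "(\<Sum>k=1..K. real p * ((\<epsilon>\<^sup>2 * m k)\<^sup>2 / 2)) = 2 * (\<Delta>\<^sup>2)\<^sup>2 / real p * (\<Sum>k=1..K. m k * m k)"
      unfolding sum_distrib_left \<epsilon> using pos
      by (intro sum.cong refl) (simp add: power2_eq_square field_simps)
    also have "exp (2 * (\<Delta>\<^sup>2)\<^sup>2 / real p * (\<Sum>k=1..K. m k * m k)) \<le> exp (real n * ln (real K) / 8)"
    proof (subst exp_le_cancel_iff)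
      have "(\<Sum>k=1..K. m k * m k) \<le> (\<Sum>k=1..K. 3 * real n / (2 * real K) * m k)"
        using m_le m0 by (intro sum_mono mult_right_mono) auto
      also have "\<dots> = 3 * real n / (2 * real K) * real n"
        by (simp only: sum_distrib_left[symmetric] sum_m)
      finally have "2 * (\<Delta>\<^sup>2)\<^sup>2 / real p * (\<Sum>k=1..K. m k * m k)
          \<le> 2 * ((1 / 24)\<^sup>2 * R) / real p * (3 * real n / (2 * real K) * real n)"
        using \<Delta>4 m0 R by (intro mult_mono divide_right_mono mult_left_mono) (auto intro!: sum_nonneg)
      also have "\<dots> = real n * ln (real K) / 192"
        unfolding R_def using pos by (simp add: power2_eq_square field_simps)
      also have "\<dots> \<le> real n * ln (real K) / 8" using pos by simp
      finally show "2 * (\<Delta>\<^sup>2)\<^sup>2 / real p * (\<Sum>k=1..K. m k * m k) \<le> real n * ln (real K) / 8" .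
    qed
    finally show ?thesis .
  qed
  then show ?thesis unfolding m_def .
qed

text \<open>This fixes the threshold on \<open>K\<close>: with \<open>K \<ge> (16 * 9)^8\<close> the right-hand side is at least \<open>(16 * 9)^n\<close>.\<close>

lemma nine_power_le_exp:
  assumes K: "144 ^ 8 \<le> real K" and n: "1 \<le> n"
  shows "16 * 9 ^ n \<le> exp (real n * ln (real K) / 8)"
proof -
  have "(16::real) * 9 ^ n \<le> 16 ^ n * 9 ^ n"
    using n power_increasing[of 1 n "16::real"] by (intro mult_right_mono) auto
  also have "\<dots> = 144 ^ n" by (simp flip: power_mult_distrib)
  also have "(144::real) ^ n = exp (real n * ln 144)" by (simp add: exp_of_nat_mult)
  also have "\<dots> \<le> exp (real n * (ln (real K) / 8))"
  proof (subst exp_le_cancel_iff, rule mult_left_mono)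
    have "ln ((144::real) ^ 8) \<le> ln (real K)"
      using K by (subst ln_le_cancel_iff) auto
    moreover have "ln ((144::real) ^ 8) = 8 * ln 144"
      by (subst ln_realpow) simp_all
    ultimately show "ln 144 \<le> ln (real K) / 8" by linarith
  qed simp
  finally show ?thesis by simp
qed

lemma clustering_error_nonneg: "0 \<le> clustering_error n K G' G"
  by (simp add: clustering_error_def)

lemma borel_measurable_clustering_error:
  assumes "Ghat \<in> estimators n p K"
  shows "(\<lambda>Y. clustering_error n K (Ghat Y) G) \<in> borel_measurable (observation_space n p)"
  using assms unfolding estimators_def
  by (rule measurable_compose) simp

text \<open>Markov's inequality. Integrability holds since there are finitely many partitions.\<close>

lemma expected_clustering_error_ge:
  assumes Ghat: "Ghat \<in> estimators n p K"
    and D: "prob_space D" "sets D = sets (observation_space n p)"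
    and small: "measure D {Y\<in>space D. clustering_error n K (Ghat Y) G < 1 / 8} \<le> 3 / 8"
  shows "5 / 64 \<le> (\<integral>Y. clustering_error n K (Ghat Y) G \<partial>D)"
proof -
  interpret D: prob_space D by fact
  let ?e = "\<lambda>Y. clustering_error n K (Ghat Y) G"
  let ?A = "{Y\<in>space D. ?e Y < 1 / 8}"
  have meas [measurable]: "?e \<in> borel_measurable D"
    using borel_measurable_clustering_error[OF Ghat] by (simp cong: measurable_cong_sets add: D(2))
  have A: "?A \<in> sets D" by measurable
  define b where "b = Max ((\<lambda>G'. clustering_error n K G' G) ` numbered_partitions n K)"
  have "integrable D ?e"
  proof (rule D.integrable_const_bound[of _ b], rule AE_I2)
    fix Y assume "Y \<in> space D"
    then have "Y \<in> space (observation_space n p)" using sets_eq_imp_space_eq[OF D(2)] by simp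
    then have "Ghat Y \<in> numbered_partitions n K"
      using measurable_space[OF Ghat[unfolded estimators_def]] by simp
    then show "norm (?e Y) \<le> b"
      unfolding b_def using finite_numbered_partitions clustering_error_nonneg by auto
  qed measurable
  moreover have "integrable D (\<lambda>Y. 1 / 8 * indicator (space D - ?A) Y :: real)"
    using A by (intro integrable_mult_right integrable_real_indicator)
      (auto simp: D.emeasure_eq_measure)
  ultimately have "(\<integral>Y. 1 / 8 * indicator (space D - ?A) Y \<partial>D) \<le> (\<integral>Y. ?e Y \<partial>D)"
    using clustering_error_nonneg by (intro integral_mono) (auto simp: indicator_def not_less)
  moreover have "(\<integral>Y. 1 / 8 * indicator (space D - ?A) Y \<partial>D) = (1::real) / 8 * (1 - measure D ?A)"
    using A D.prob_compl[OF A] by simp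
  ultimately show ?thesis using small by simp
qed

text \<open>The hypotheses are the permutations \<open>\<tau>\<close>, mixed over the separated sign matrices, and the event \<open>A \<tau>\<close> is that
  the estimator comes within error \<open>1 / 8\<close> of the shuffled partition. The quantity \<open>W\<close> bounds the product of \<open>prod_cosh_le\<close>.\<close>

lemma exists_hard_partition_and_means:
  assumes p: "24 * ln (real K) \<le> real p" and K: "144 ^ 8 \<le> real K" and n: "2 * K \<le> n"
    and \<sigma>: "0 < \<sigma>"
    and \<Delta>: "\<Delta>\<^sup>2 \<le> 1 / 24 * max (ln (real K)) (sqrt (real p * real K * ln (real K) / real n))"
    and \<alpha>: "3 / 2 \<le> \<alpha>" and Ghat: "Ghat \<in> estimators n p K"
  shows "\<exists>G\<in>balanced_partitions n K \<alpha>. \<exists>\<mu>\<in>separated_means p K \<sigma> \<Delta>.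
    5 / 64 \<le> (\<integral>Y. clustering_error n K (Ghat Y) G \<partial>sample_law n p K \<sigma> \<mu> G)"
proof -
  have "2 \<le> real K" using K by simp
  then have K2: "2 \<le> K" and K1: "1 \<le> K" by auto
  have n1: "1 \<le> n" using n K1 by simp
  have "0 < real p" using p ln_gt_zero[of "real K"] K2 by linarith
  then have p1: "1 \<le> p" by simp
  define \<epsilon> where "\<epsilon> = sqrt (2 * \<Delta>\<^sup>2 / real p)"
  have \<epsilon>: "\<epsilon>\<^sup>2 = 2 * \<Delta>\<^sup>2 / real p" by (simp add: \<epsilon>_def)
  define Q where "Q = noise_law n p \<sigma>"
  define T where "T = {\<tau>. \<tau> permutes {1..n}}"
  define S where "S = separated_sign_matrices K p"
  define m where "m \<tau> s = (\<lambda>i j. \<sigma> * \<epsilon> * s (base_label K (\<tau> i)) j)" for \<tau> :: "nat \<Rightarrow> nat" and s :: "nat \<Rightarrow> nat \<Rightarrow> real"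
  define W where "W = exp (real n * ln (real K) / 8)"
  define A where "A \<tau> = {Y\<in>space Q. clustering_error n K (Ghat Y) (shuffled_groups n K \<tau>) < 1 / 8}" for \<tau>
  have sets_Q: "sets Q = sets (observation_space n p)" unfolding Q_def by (rule sets_signal_law)
  have law: "density Q (\<lambda>y. ennreal (likelihood n p \<sigma> (m \<tau> s) y)) = signal_law n p \<sigma> (m \<tau> s)" for \<tau> s
    unfolding Q_def by (rule signal_law_eq_density[OF \<sigma>, symmetric])
  have T: "finite T" "card T = fact n"
    unfolding T_def by (simp_all add: finite_permutations card_permutations[of _ n])
  have S: "finite S" "S \<noteq> {}"
  proof -
    show "finite S" by (rule finite_subset[OF _ finite_sign_matrices]) (auto simp: S_def separated_sign_matrices_def)
    have "0 < real (card (sign_matrices K p))" by (simp add: card_sign_matrices)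
    then show "S \<noteq> {}"
      using card_separated_sign_matrices[OF K2 p] unfolding S_def by auto
  qed
  have "\<exists>\<tau>\<in>T. \<exists>s\<in>S. measure (density Q (\<lambda>y. ennreal (likelihood n p \<sigma> (m \<tau> s) y))) (A \<tau>) \<le> 3 / 8"
  proof (rule exists_hard_hypothesis[where V = "2 * W"])
    show "prob_space Q" unfolding Q_def by (rule prob_space_signal_law[OF \<sigma>])
    show "finite T" "finite S" "S \<noteq> {}" by fact+
    show "T \<noteq> {}" using T by (metis card.empty fact_nonzero)
    show "0 < 2 * W" by (simp add: W_def)
    show "likelihood n p \<sigma> (m \<tau> s) \<in> borel_measurable Q" for \<tau> s
      using borel_measurable_likelihood by (simp cong: measurable_cong_sets add: sets_Q)
    show "0 \<le> likelihood n p \<sigma> (m \<tau> s) y" for \<tau> s y by (rule likelihood_nonneg)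
    show "prob_space (density Q (\<lambda>y. ennreal (likelihood n p \<sigma> (m \<tau> s) y)))" for \<tau> s
      unfolding law by (rule prob_space_signal_law[OF \<sigma>])
    show "A \<tau> \<in> sets Q" for \<tau>
    proof -
      have [measurable]: "(\<lambda>Y. clustering_error n K (Ghat Y) (shuffled_groups n K \<tau>)) \<in> borel_measurable Q"
        using borel_measurable_clustering_error[OF Ghat] by (simp cong: measurable_cong_sets add: sets_Q)
      show ?thesis unfolding A_def by measurable
    qed
    show "(\<integral>\<^sup>+y. ennreal ((\<Sum>s\<in>S. likelihood n p \<sigma> (m \<tau> s) y)\<^sup>2) \<partial>Q)
        \<le> ennreal (2 * W * (real (card S))\<^sup>2)" if "\<tau> \<in> T" for \<tau>
    proof -
      have "(\<integral>\<^sup>+y. ennreal ((\<Sum>s\<in>S. likelihood n p \<sigma> (m \<tau> s) y)\<^sup>2) \<partial>Q)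
          \<le> ennreal (2 * (\<Prod>k=1..K. cosh (\<epsilon>\<^sup>2 * real (card {i\<in>{1..n}. base_label K i = k})) ^ p)
            * (real (card S))\<^sup>2)"
        unfolding Q_def S_def m_def
        by (rule second_moment_mixture[OF \<sigma> K2 p]) (use that in \<open>simp add: T_def\<close>)
      also have "\<dots> \<le> ennreal (2 * W * (real (card S))\<^sup>2)"
        unfolding W_def by (intro ennreal_leI mult_right_mono mult_left_mono prod_cosh_le[OF K2 n p1 \<epsilon> \<Delta>]) auto
      finally show ?thesis .
    qed
    show "real (card {\<tau> \<in> T. y \<in> A \<tau>}) \<le> real (card T) / (8 * (2 * W))" if y: "y \<in> space Q" for y
    proof -
      have "Ghat y \<in> numbered_partitions n K"
        using measurable_space[OF Ghat[unfolded estimators_def], of y] y sets_eq_imp_space_eq[OF sets_Q] by simp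
      from small_clustering_error_rare[OF this K1 n]
      have "real (card {\<tau> \<in> T. y \<in> A \<tau>}) \<le> fact n * 9 ^ n * exp (- (real n * ln (real K) / 4))"
        using y by (simp add: T_def A_def)
      \<comment> \<open>One factor \<open>W\<close> pays for \<open>9^n\<close>, the other for the second moment.\<close>
      also have "exp (- (real n * ln (real K) / 4)) = 1 / (W * W)"
        by (simp add: W_def exp_minus inverse_eq_divide flip: exp_add)
      also have "fact n * 9 ^ n * (1 / (W * W)) = fact n / (16 * W) * (16 * 9 ^ n / W)"
        by simp
      also have "\<dots> \<le> fact n / (16 * W) * 1"
        using nine_power_le_exp[OF K n1] by (intro mult_left_mono) (simp_all add: W_def)
      finally show ?thesis using T by simp
    qed
  qed
  then obtain \<tau> s where \<tau>: "\<tau> permutes {1..n}" and s: "s \<in> separated_sign_matrices K p"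
    and small: "measure (signal_law n p \<sigma> (m \<tau> s)) (A \<tau>) \<le> 3 / 8"
    unfolding law T_def S_def by auto
  let ?G = "shuffled_groups n K \<tau>" and ?\<mu> = "scaled_means p K (\<sigma> * \<epsilon>) s"
  have eq: "sample_law n p K \<sigma> ?\<mu> ?G = signal_law n p \<sigma> (m \<tau> s)"
    unfolding m_def by (rule sample_law_shuffled[OF K1])
  have space: "space (signal_law n p \<sigma> (m \<tau> s)) = space Q"
    by (rule sets_eq_imp_space_eq) (simp add: sets_signal_law sets_Q)
  have "5 / 64 \<le> (\<integral>Y. clustering_error n K (Ghat Y) ?G \<partial>signal_law n p \<sigma> (m \<tau> s))"
    using small unfolding A_def
    by (intro expected_clustering_error_ge[OF Ghat prob_space_signal_law[OF \<sigma>] sets_signal_law])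
      (simp add: space)
  moreover have "?\<mu> \<in> separated_means p K \<sigma> \<Delta>"
    using \<epsilon> by (intro scaled_means_separated[OF s p1 \<sigma>]) (simp add: power_mult_distrib)
  ultimately show ?thesis
    using shuffled_groups_balanced[OF K1 n \<alpha> \<tau>] unfolding eq[symmetric] by blast
qed

theorem theorem3:
  shows "\<exists>(c::real) (c'::real) (C::real) (K0::real). c > 0 \<and> c' > 0 \<and> C > 0 \<and> K0 > 0 \<and>
    (\<forall>(p::nat) (K::nat) (n::nat) (\<alpha>::real) (\<sigma>::real) (\<Delta>::real).
      real p \<ge> c * ln (real K) \<longrightarrow> real K \<ge> K0 \<longrightarrow> n \<ge> 2 * K \<longrightarrow> \<alpha> \<ge> 3 / 2 \<longrightarrow>
      \<sigma> > 0 \<longrightarrow> \<Delta> > 0 \<longrightarrow>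
      \<Delta>\<^sup>2 \<le> c' * max (ln (real K)) (sqrt (real p * real K * ln (real K) / real n)) \<longrightarrow>
      (\<forall>Ghat \<in> estimators n p K.
        (SUP G \<in> balanced_partitions n K \<alpha>. SUP \<mu> \<in> separated_means p K \<sigma> \<Delta>.
           ereal (\<integral>Y. clustering_error n K (Ghat Y) G \<partial>(sample_law n p K \<sigma> \<mu> G))) \<ge> ereal C))"
proof (rule exI[of _ 24], rule exI[of _ "1 / 24"], rule exI[of _ "5 / 64"], rule exI[of _ "144 ^ 8"],
    intro conjI allI impI ballI)
  fix p K n :: nat and \<alpha> \<sigma> \<Delta> :: real and Ghat
  assume "24 * ln (real K) \<le> real p" "144 ^ 8 \<le> real K" "2 * K \<le> n" "3 / 2 \<le> \<alpha>" "0 < \<sigma>"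
    "\<Delta>\<^sup>2 \<le> 1 / 24 * max (ln (real K)) (sqrt (real p * real K * ln (real K) / real n))"
    "Ghat \<in> estimators n p K"
  then obtain G \<mu> where "G \<in> balanced_partitions n K \<alpha>" "\<mu> \<in> separated_means p K \<sigma> \<Delta>"
    "5 / 64 \<le> (\<integral>Y. clustering_error n K (Ghat Y) G \<partial>sample_law n p K \<sigma> \<mu> G)"
    using exists_hard_partition_and_means by metis
  then show "ereal (5 / 64) \<le> (SUP G \<in> balanced_partitions n K \<alpha>. SUP \<mu> \<in> separated_means p K \<sigma> \<Delta>.
      ereal (\<integral>Y. clustering_error n K (Ghat Y) G \<partial>(sample_law n p K \<sigma> \<mu> G)))"
    by (intro SUP_upper2[of G] SUP_upper2[of \<mu>]) simp_all
qed simp_all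

end
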